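(* An ABC voting rule $f$ (for fixed $m\ge 2$ and fixed committee size $k\in\{1,\dots,m-1\}$) is a BSWAV rule if and only if it satisfies anonymity, neutrality, consistency, continuity, choice set convexity, and weak efficiency.
   Context: Let $\mathcal C=\{c_1,\dots,c_m\}$ be a set of $m\ge 2$ candidates and $\mathbb N=\{1,2,\dots\}$ the set of potential voters. An electorate is a non-empty finite $N\subseteq\mathbb N$. An approval ballot is a non-empty subset of $\mathcal C$; $\mathcal A$ is the set of all ballots. A profile is a map $A:N\to\mathcal A$ for some electorate $N=N_A$, with $A_i$ the ballot of voter $i$; $\mathcal A^*$ is the set of all profiles. Profiles $A,A'$ are disjoint if $N_A\cap N_{A'}=\emptyset$, and then $A+A'$ is the profile on $N_A\cup N_{A'}$ agreeing with $A$ on $N_A$ and with $A'$ on $N_{A'}$. For $\lambda\in\mathbb N$, $\lambda A$ denotes a profile consisting of $\lambda$ copies of $A$ on pairwise disjoint voter sets. Fix $k\in\{1,\dots,m-1\}$; $\mathcal W_k=\{W\subseteq\mathcal C:|W|=k\}$ is the set of committees. An ABC voting rule is a map $f:\mathcal A^*\to 2^{\mathcal W_k}\setminus\{\emptyset\}$. Axioms: $f$ is anonymous if $f(A)=f(\pi(A))$ for all $A$ and permutations $\pi$ of $\mathbb N$, where $\pi(A)$ has electorate $\pi(N_A)$ and $\pi(A)_{\pi(i)}=A_i$. $f$ is neutral if $f(\tau(A))=\{\tau(W):W\in f(A)\}$ for all $A$ and permutations $\tau$ of $\mathcal C$, where $\tau(A)_i=\tau(A_i)$. $f$ is consistent if $f(A+A')=f(A)\cap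 f(A')$ for all disjoint $A,A'$ with $f(A)\cap f(A')\neq\emptyset$. $f$ is continuous if for all profiles $A,A'$ there is $\lambda\in\mathbb N$ with $f(\lambda A+A')\subseteq f(A)$. $f$ is weakly efficient if whenever $W\in f(A)$ and $c\in W\setminus\bigcup_{i\in N_A}A_i$, then $(W\cup\{c'\})\setminus\{c\}\in f(A)$ for every $c'\in\mathcal C\setminus W$. $f$ is choice set convex if $W,W'\in f(A)$ implies $W''\in f(A)$ for every $W''\in\mathcal W_k$ with $W\cap W'\subseteq W''\subseteq W\cup W'$. A BSWAV (ballot size weighted approval voting) rule is defined by a weight vector $\alpha=(\alpha_1,\dots,\alpha_m)\in\mathbb R^m_{\ge0}$ and chooses, for every profile $A$, the committees $W\in\mathcal W_k$ maximizing $\hat s(A,W)=\sum_{i\in N_A}\alpha_{|A_i|}\,|A_i\cap W|$. *)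

theory Defs
  imports Complex_Main
begin

(* Voters are positive naturals; a profile is a finite partial map from voters to ballots.
   Its electorate is dom A. *)
type_synonym 'c profile = "nat \<rightharpoonup> 'c set"

definition is_profile :: "'c profile \<Rightarrow> bool" where
  "is_profile A \<longleftrightarrow> finite (dom A) \<and> dom A \<noteq> {} \<and> 0 \<notin> dom A
     \<and> (\<forall>i\<in>dom A. the (A i) \<noteq> {})"

definition committees :: "nat \<Rightarrow> 'c set set" where
  "committees k = {W. card W = k}"

definition abc_rule :: "nat \<Rightarrow> ('c profile \<Rightarrow> 'c set set) \<Rightarrow> bool" where
  "abc_rule k f \<longleftrightarrow> (\<forall>A. is_profile A \<longrightarrow> f A \<subseteq> committees k \<and> f A \<noteq> {})"

definition voter_perm :: "(nat \<Rightarrow> nat) \<Rightarrow> bool" where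
  "voter_perm \<pi> \<longleftrightarrow> bij_betw \<pi> {0<..} {0<..}"

definition rename_voters :: "(nat \<Rightarrow> nat) \<Rightarrow> 'c profile \<Rightarrow> 'c profile" where
  "rename_voters \<pi> A = (\<lambda>j. if j \<in> \<pi> ` dom A then A (inv_into (dom A) \<pi> j) else None)"

definition anonymous :: "('c profile \<Rightarrow> 'c set set) \<Rightarrow> bool" where
  "anonymous f \<longleftrightarrow> (\<forall>A \<pi>. is_profile A \<longrightarrow> voter_perm \<pi> \<longrightarrow> f (rename_voters \<pi> A) = f A)"

definition rename_cands :: "('c \<Rightarrow> 'c) \<Rightarrow> 'c profile \<Rightarrow> 'c profile" where
  "rename_cands \<tau> A = map_option (image \<tau>) \<circ> A"

definition neutral :: "('c profile \<Rightarrow> 'c set set) \<Rightarrow> bool" where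
  "neutral f \<longleftrightarrow> (\<forall>A \<tau>. is_profile A \<longrightarrow> bij \<tau> \<longrightarrow> f (rename_cands \<tau> A) = image \<tau> ` f A)"

definition disjoint_profiles :: "'c profile \<Rightarrow> 'c profile \<Rightarrow> bool" where
  "disjoint_profiles A A' \<longleftrightarrow> dom A \<inter> dom A' = {}"

definition consistent :: "('c profile \<Rightarrow> 'c set set) \<Rightarrow> bool" where
  "consistent f \<longleftrightarrow> (\<forall>A A'. is_profile A \<longrightarrow> is_profile A' \<longrightarrow> disjoint_profiles A A' \<longrightarrow>
      f A \<inter> f A' \<noteq> {} \<longrightarrow> f (A ++ A') = f A \<inter> f A')"

definition copies :: "nat \<Rightarrow> 'c profile \<Rightarrow> 'c profile \<Rightarrow> bool" where
  "copies l A B \<longleftrightarrow> (\<exists>\<sigma> :: nat \<Rightarrow> nat \<Rightarrow> nat.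
      (\<forall>j<l. inj_on (\<sigma> j) (dom A) \<and> \<sigma> j ` dom A \<subseteq> {0<..}) \<and>
      (\<forall>j<l. \<forall>j'<l. j \<noteq> j' \<longrightarrow> \<sigma> j ` dom A \<inter> \<sigma> j' ` dom A = {}) \<and>
      dom B = (\<Union>j<l. \<sigma> j ` dom A) \<and>
      (\<forall>j<l. \<forall>i\<in>dom A. B (\<sigma> j i) = A i))"

definition continuous_rule :: "('c profile \<Rightarrow> 'c set set) \<Rightarrow> bool" where
  "continuous_rule f \<longleftrightarrow> (\<forall>A A'. is_profile A \<longrightarrow> is_profile A' \<longrightarrow>
      (\<exists>l::nat. l \<ge> 1 \<and> (\<forall>B. copies l A B \<longrightarrow> disjoint_profiles B A' \<longrightarrow>
          f (B ++ A') \<subseteq> f A)))"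

definition weakly_efficient :: "('c profile \<Rightarrow> 'c set set) \<Rightarrow> bool" where
  "weakly_efficient f \<longleftrightarrow> (\<forall>A W c c'. is_profile A \<longrightarrow> W \<in> f A \<longrightarrow> c \<in> W \<longrightarrow>
      c \<notin> (\<Union>i\<in>dom A. the (A i)) \<longrightarrow> c' \<notin> W \<longrightarrow> (W \<union> {c'}) - {c} \<in> f A)"

definition choice_set_convex :: "nat \<Rightarrow> ('c profile \<Rightarrow> 'c set set) \<Rightarrow> bool" where
  "choice_set_convex k f \<longleftrightarrow> (\<forall>A W W' W''. is_profile A \<longrightarrow> W \<in> f A \<longrightarrow> W' \<in> f A \<longrightarrow>
      W'' \<in> committees k \<longrightarrow> W \<inter> W' \<subseteq> W'' \<longrightarrow> W'' \<subseteq> W \<union> W' \<longrightarrow> W'' \<in> f A)"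

definition bswav_score :: "(nat \<Rightarrow> real) \<Rightarrow> 'c profile \<Rightarrow> 'c set \<Rightarrow> real" where
  "bswav_score \<alpha> A W = (\<Sum>i\<in>dom A. \<alpha> (card (the (A i))) * real (card (the (A i) \<inter> W)))"

(* alpha is indexed by ballot sizes 1..m; values elsewhere are irrelevant *)
definition is_bswav :: "nat \<Rightarrow> ('c profile \<Rightarrow> 'c set set) \<Rightarrow> bool" where
  "is_bswav k f \<longleftrightarrow> (\<exists>\<alpha> :: nat \<Rightarrow> real. (\<forall>s. \<alpha> s \<ge> 0) \<and>
      (\<forall>A. is_profile A \<longrightarrow> f A = {W \<in> committees k.
          \<forall>W'\<in>committees k. bswav_score \<alpha> A W' \<le> bswav_score \<alpha> A W}))"

end

theory Submission
  imports Defs "HOL-Combinatorics.Permutations" "HOL-Library.Function_Algebras" "HOL-Library.Nat_Bijection"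
begin

text \<open>
  By anonymity a profile is its vector of ballot counts. The profile containing every ballot once
  elects all committees, so a rule \<open>f\<close> satisfying the axioms extends to a map \<open>g\<close> on all integer
  vectors indexed by ballots, and consistency says \<open>g (u + v) = g u \<inter> g v\<close> whenever the right-hand side
  is nonempty. Write \<open>(a b)\<close> for the transposition of two candidates.

  If \<open>e\<close> is negated by \<open>(a b)\<close> and \<open>g e\<close> contains both \<open>W\<close> and its image under \<open>(a b)\<close>, then
  \<open>W \<in> g e \<inter> g (- e)\<close>, so \<open>g e\<close> consists of all committees. If \<open>e\<close> is negated by both \<open>(a b)\<close> and
  \<open>(c d)\<close>, choice set convexity yields such a \<open>W\<close>. Hence, up to vectors that do not influence the
  outcome, the difference between \<open>v\<close> and its image under \<open>(a b)\<close> only depends on how much more often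
  \<open>b\<close> is approved than \<open>a\<close> on ballots of each size.

  For a vector of this kind \<open>g\<close> selects all committees, or those with \<open>a\<close> and without \<open>b\<close>, or those with
  \<open>b\<close> and without \<open>a\<close>. This is a total preorder on integer vectors indexed by ballot sizes, Archimedean
  by continuity, so it is given by a real linear functional, whose coefficients are the weights. If \<open>b\<close>
  scores more than \<open>a\<close>, no chosen committee contains \<open>a\<close> but not \<open>b\<close>; if they tie, they can be
  exchanged. So \<open>g\<close> chooses exactly the committees of maximal score, and weak efficiency excludes
  negative weights.
\<close>

section \<open>Pointwise arithmetic, additive real functionals, permutations of finite sets\<close>

lemma of_int_fun_apply: "(of_int n :: 'a \<Rightarrow> 'b::ring_1) x = of_int n"
  by (cases n) simp_all

lemmas pointwise = plus_fun_apply zero_fun_apply one_fun_apply times_fun_apply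
  minus_apply uminus_apply of_nat_fun_apply of_int_fun_apply

text \<open>As default simplification rules these would unfold sums of functions under a functional.\<close>

declare pointwise [simp del]

lemma sum_fun_apply: "(\<Sum>i\<in>I. F i) x = (\<Sum>i\<in>I. F i x)"
  by (induction I rule: infinite_finite_induct) (simp_all add: pointwise)

text \<open>Hoelder's embedding of Archimedean ordered groups into the reals, by Dedekind cuts relative to
  a fixed positive element \<open>p\<close>. A ring is assumed only to have integer multiples at hand.\<close>

lemma archimedean_preorder_functional:
  fixes Q :: "'a::comm_ring_1 set"
  assumes add: "\<And>x y. x \<in> Q \<Longrightarrow> y \<in> Q \<Longrightarrow> x + y \<in> Q"
    and total: "\<And>x. x \<in> Q \<or> - x \<in> Q"
    and arch: "\<And>x y. - x \<notin> Q \<Longrightarrow> \<exists>n::nat. of_nat n * x + y \<in> Q"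
  obtains \<phi> :: "'a \<Rightarrow> real"
  where "\<And>x y. \<phi> (x + y) = \<phi> x + \<phi> y" and "\<And>x. x \<in> Q \<longleftrightarrow> 0 \<le> \<phi> x"
proof (cases "\<exists>p. - p \<notin> Q")
  \<comment> \<open>Without a strictly positive element \<open>Q\<close> is everything, and the zero
    functional represents it.\<close>
  case False
  then have "x \<in> Q" for x by (metis minus_minus)
  then show ?thesis using that[of "\<lambda>_. 0"] by simp
next
  case True
  then obtain p where p: "- p \<notin> Q" by blast
  have zero: "0 \<in> Q" using total[of 0] by simp
  have scale_nat: "of_nat n * x \<in> Q" if "x \<in> Q" for n x
    by (induction n) (use that zero add in \<open>auto simp: algebra_simps\<close>)
  have scale: "of_int n * x \<in> Q" if "x \<in> Q" "n \<ge> 0" for n x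
    using scale_nat[OF that(1), of "nat n"] that(2) by simp
  \<comment> \<open>If \<open>i\<close> were negative, adding \<open>- i - 1\<close> copies of
    \<open>p\<close> to \<open>i\<close> copies of \<open>p\<close> would put \<open>- p\<close>
    into \<open>Q\<close>.\<close>
  have multiple: "0 \<le> i" if "of_int i * p \<in> Q" for i
  proof (rule ccontr)
    assume "\<not> 0 \<le> i"
    then have "of_int (- i - 1) * p \<in> Q"
      using p total[of p] by (intro scale) auto
    from add[OF that this] show False using p by (simp add: algebra_simps)
  qed
  \<comment> \<open>The lower cut of the ratio of \<open>x\<close> to \<open>p\<close>: reading
    \<open>x - y \<in> Q\<close> as \<open>y \<le> x\<close>, it collects the fractions
    \<open>i / n\<close> for which \<open>i\<close> copies of \<open>p\<close> lie below
    \<open>n\<close> copies of \<open>x\<close>.\<close>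
  define S where "S x = {real_of_int i / real_of_int n | i n. n > 0 \<and> of_int n * x - of_int i * p \<in> Q}" for x
  have S_add: "q + r \<in> S (x + y)" if qr: "q \<in> S x" "r \<in> S y" for q r x y
  proof -
    obtain i n where 1: "q = real_of_int i / real_of_int n" "n > 0" "of_int n * x - of_int i * p \<in> Q"
      using qr(1) unfolding S_def by blast
    obtain j l where 2: "r = real_of_int j / real_of_int l" "l > 0" "of_int l * y - of_int j * p \<in> Q"
      using qr(2) unfolding S_def by blast
    have "of_int l * (of_int n * x - of_int i * p) + of_int n * (of_int l * y - of_int j * p) \<in> Q"
      using 1 2 by (intro add scale) auto
    then have "of_int (n * l) * (x + y) - of_int (i * l + j * n) * p \<in> Q"
      by (simp add: algebra_simps)
    moreover have "q + r = real_of_int (i * l + j * n) / real_of_int (n * l)"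
      using 1 2 by (simp add: field_simps)
    ultimately show ?thesis unfolding S_def using 1 2
      by (intro CollectI exI[of _ "i * l + j * n"] exI[of _ "n * l"]) simp
  qed
  have S_zero: "q \<le> 0" if q: "q \<in> S 0" for q
  proof -
    obtain i n where 1: "q = real_of_int i / real_of_int n" "n > 0" "of_int n * 0 - of_int i * p \<in> Q"
      using q unfolding S_def by blast
    then have "0 \<le> - i" by (intro multiple) simp
    then show ?thesis using 1 by (simp add: divide_nonpos_pos)
  qed
  \<comment> \<open>Totality of the preorder leaves no rational gap between the cut of
    \<open>x\<close> and the negated cut of \<open>- x\<close>; this is what makes
    \<open>\<phi>\<close> odd below.\<close>
  have S_total: "q \<in> S x \<or> - q \<in> S (- x)" if "q \<in> \<rat>" for q x
  proof -
    from that obtain i n where 1: "n > 0" "q = real_of_int i / real_of_int n"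
      by (metis Rats_cases')
    have "of_int n * x - of_int i * p \<in> Q \<or> of_int n * (- x) - of_int (- i) * p \<in> Q"
      using total[of "of_int n * x - of_int i * p"] by (simp add: algebra_simps)
    then show ?thesis
    proof
      assume "of_int n * x - of_int i * p \<in> Q"
      then show ?thesis unfolding S_def using 1 by blast
    next
      assume "of_int n * (- x) - of_int (- i) * p \<in> Q"
      moreover have "- q = real_of_int (- i) / real_of_int n" using 1 by simp
      ultimately show ?thesis unfolding S_def using 1 by blast
    qed
  qed
  have S_ne: "S x \<noteq> {}" for x
  proof -
    obtain n where "of_nat n * p + x \<in> Q" using arch[OF p] by blast
    then have "of_int 1 * x - of_int (- int n) * p \<in> Q" by (simp add: algebra_simps)
    then show ?thesis unfolding S_def by (metis (mono_tags, lifting) empty_Collect_eq zero_less_one)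
  qed
  have S_opp: "q \<le> - r" if "q \<in> S x" "r \<in> S (- x)" for q r x
    using S_zero[of "q + r"] S_add[OF that] by simp
  have bdd: "bdd_above (S x)" for x
  proof -
    obtain r where "r \<in> S (- x)" using S_ne by blast
    then show ?thesis using S_opp by (intro bdd_aboveI[of _ "- r"]) blast
  qed
  define \<phi> where "\<phi> x = Sup (S x)" for x
  have upper: "q \<le> \<phi> x" if "q \<in> S x" for q x
    unfolding \<phi>_def using that bdd by (rule cSup_upper)
  have super: "\<phi> x + \<phi> y \<le> \<phi> (x + y)" for x y
  proof -
    have "q \<le> \<phi> (x + y) - r" if "q \<in> S x" "r \<in> S y" for q r
      using upper[OF S_add[OF that]] by simp
    then have "\<phi> x \<le> \<phi> (x + y) - r" if "r \<in> S y" for r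
      unfolding \<phi>_def[of x] using S_ne that by (intro cSup_least) auto
    then have "r \<le> \<phi> (x + y) - \<phi> x" if "r \<in> S y" for r
      using that by (metis add.commute le_diff_eq)
    then have "\<phi> y \<le> \<phi> (x + y) - \<phi> x"
      unfolding \<phi>_def[of y] using S_ne by (intro cSup_least) auto
    then show ?thesis by simp
  qed
  \<comment> \<open>One inequality is superadditivity at \<open>x\<close> and \<open>- x\<close>. If
    the other failed, a rational strictly between \<open>\<phi> x\<close> and
    \<open>- \<phi> (- x)\<close> would contradict \<open>S_total\<close>. Oddness then upgrades
    superadditivity to additivity.\<close>
  have neg: "\<phi> (- x) = - \<phi> x" for x
  proof (rule antisym)
    have "\<phi> 0 \<le> 0" unfolding \<phi>_def using S_ne S_zero by (intro cSup_least) auto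
    then show "\<phi> (- x) \<le> - \<phi> x" using super[of x "- x"] by simp
    show "- \<phi> x \<le> \<phi> (- x)"
    proof (rule ccontr)
      assume "\<not> - \<phi> x \<le> \<phi> (- x)"
      then obtain q where q: "q \<in> \<rat>" "\<phi> x < q" "q < - \<phi> (- x)"
        using Rats_dense_in_real[of "\<phi> x" "- \<phi> (- x)"] by auto
      from S_total[OF q(1), of x] show False using upper[of q x] upper[of "- q" "- x"] q by auto
    qed
  qed
  show ?thesis
  proof
    show "\<phi> (x + y) = \<phi> x + \<phi> y" for x y
      using super[of x y] super[of "- x" "- y"] neg[of x] neg[of y] neg[of "x + y"] by simp
    have nonneg: "0 \<le> \<phi> x" if "x \<in> Q" for x
    proof (rule upper)
      show "0 \<in> S x" unfolding S_def using that
        by (intro CollectI exI[of _ 0] exI[of _ 1]) simp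
    qed
    \<comment> \<open>Some multiple of a strictly positive \<open>x\<close> exceeds
      \<open>p\<close>, so a fraction \<open>1 / n\<close> lies in its cut. Hence
      \<open>\<phi>\<close> does not vanish on strictly positive elements.\<close>
    have pos: "0 < \<phi> x" if "- x \<notin> Q" for x
    proof -
      from arch[OF that] obtain n where n: "of_nat n * x + (- p) \<in> Q" by blast
      then have "n \<noteq> 0" using p by (cases n) auto
      then have "1 / real n \<in> S x" unfolding S_def using n
        by (intro CollectI exI[of _ 1] exI[of _ "int n"]) simp
      then have "1 / real n \<le> \<phi> x" by (rule upper)
      moreover have "0 < 1 / real n" using \<open>n \<noteq> 0\<close> by simp
      ultimately show ?thesis by linarith
    qed
    show "x \<in> Q \<longleftrightarrow> 0 \<le> \<phi> x" for x
      using nonneg[of x] pos[of "- x"] neg[of x] by fastforce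
  qed
qed

lemma additive_of_int_mult:
  fixes \<phi> :: "'a::comm_ring_1 \<Rightarrow> real"
  assumes add: "\<And>x y. \<phi> (x + y) = \<phi> x + \<phi> y"
  shows "\<phi> (of_int i * x) = real_of_int i * \<phi> x"
proof -
  have zero: "\<phi> 0 = 0" using add[of 0 0] by simp
  have neg: "\<phi> (- x) = - \<phi> x" for x using add[of x "- x"] zero by simp
  have nat: "\<phi> (of_nat n * x) = real n * \<phi> x" for n x
    by (induction n) (simp_all add: zero add algebra_simps)
  show ?thesis
    by (cases i rule: int_cases2) (simp_all add: nat neg)
qed

text \<open>Additivity controls finite sums only, hence the finite support. The values on unit
  vectors will supply the weights.\<close>

lemma additive_functional_sum:
  fixes \<phi> :: "('a \<Rightarrow> int) \<Rightarrow> real"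
  assumes add: "\<And>x y. \<phi> (x + y) = \<phi> x + \<phi> y" and S: "finite S" and supp: "\<And>s. s \<notin> S \<Longrightarrow> \<beta> s = 0"
  shows "\<phi> \<beta> = (\<Sum>s\<in>S. real_of_int (\<beta> s) * \<phi> (\<lambda>t. of_bool (t = s)))"
proof -
  have zero: "\<phi> 0 = 0" using add[of 0 0] by simp
  have sum: "\<phi> (\<Sum>s\<in>S. F s) = (\<Sum>s\<in>S. \<phi> (F s))" for F
    using S by (induction S) (simp_all add: zero add)
  have "\<beta> = (\<Sum>s\<in>S. of_int (\<beta> s) * (\<lambda>t. of_bool (t = s)))"
  proof
    fix t
    have "(\<Sum>s\<in>S. of_int (\<beta> s) * (\<lambda>t. of_bool (t = s))) t = (\<Sum>s\<in>S. if s = t then \<beta> s else 0)"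
      unfolding sum_fun_apply by (rule sum.cong) (auto simp: pointwise)
    then show "\<beta> t = (\<Sum>s\<in>S. of_int (\<beta> s) * (\<lambda>t. of_bool (t = s))) t"
      using S supp by simp
  qed
  then have "\<phi> \<beta> = \<phi> (\<Sum>s\<in>S. of_int (\<beta> s) * (\<lambda>t. of_bool (t = s)))" by (rule arg_cong)
  then show ?thesis by (simp only: sum additive_of_int_mult[of \<phi>, OF add])
qed

lemma ex_permutes_image_eq:
  assumes "finite S" "X \<subseteq> S" "Y \<subseteq> S" "card X = card Y"
  obtains p where "p permutes S" "p ` X = Y"
proof -
  have fin: "finite X" "finite Y" using assms finite_subset by auto
  obtain h where h: "bij_betw h X Y" using finite_same_card_bij[OF fin assms(4)] by blast
  have "card (S - X) = card (S - Y)" using assms fin by (simp add: card_Diff_subset)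
  then obtain h' where h': "bij_betw h' (S - X) (S - Y)"
    using finite_same_card_bij[of "S - X" "S - Y"] assms by blast
  define p where "p x = (if x \<in> X then h x else if x \<in> S then h' x else x)" for x
  have 1: "bij_betw p X Y" using h by (rule bij_betw_cong[THEN iffD1, rotated]) (simp add: p_def)
  have 2: "bij_betw p (S - X) (S - Y)" using h' by (rule bij_betw_cong[THEN iffD1, rotated]) (simp add: p_def)
  have "bij_betw p (X \<union> (S - X)) (Y \<union> (S - Y))"
    by (rule bij_betw_combine[OF 1 2]) blast
  moreover have "X \<union> (S - X) = S" "Y \<union> (S - Y) = S" using assms by auto
  ultimately have "bij_betw p S S" by simp
  then have "p permutes S" by (rule bij_imp_permutes) (use assms in \<open>auto simp: p_def\<close>)
  then show ?thesis using that 1 by (auto simp: bij_betw_def)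
qed

section \<open>Ballot vectors and candidate exchanges\<close>

lemma exchange_in_committees:
  fixes W :: "'c::finite set"
  shows "W \<in> committees k \<Longrightarrow> a \<in> W \<Longrightarrow> b \<notin> W \<Longrightarrow> insert b (W - {a}) \<in> committees k"
  using card_gt_0_iff[of W] by (auto simp: committees_def)

text \<open>An optimal committee cannot gain by a single exchange. Conversely, a bijection from
  \<open>W' - W\<close> to \<open>W - W'\<close> pairs each newcomer with a member that scores at
  least as much, so single exchanges decide global optimality.\<close>

lemma best_committee_iff:
  fixes t :: "'c::finite \<Rightarrow> real"
  assumes W: "W \<in> committees k"
  shows "(\<forall>W'\<in>committees k. sum t W' \<le> sum t W) \<longleftrightarrow> (\<forall>a\<in>W. \<forall>b. b \<notin> W \<longrightarrow> t b \<le> t a)"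
proof safe
  fix a b
  assume max: "\<forall>W'\<in>committees k. sum t W' \<le> sum t W" and ab: "a \<in> W" "b \<notin> W"
  have "insert b (W - {a}) \<in> committees k" using W ab by (rule exchange_in_committees)
  then have "sum t (insert b (W - {a})) \<le> sum t W" using max by blast
  moreover have "sum t (insert b (W - {a})) = t b + (sum t W - t a)"
    using ab by (simp add: sum_diff1)
  ultimately show "t b \<le> t a" by simp
next
  fix W' :: "'c set"
  assume exch: "\<forall>a\<in>W. \<forall>b. b \<notin> W \<longrightarrow> t b \<le> t a" and W': "W' \<in> committees k"
  have eq: "card (W' - W) = card (W - W')"
    using W W' card_le_sym_Diff[of W W'] card_le_sym_Diff[of W' W] by (simp add: committees_def)
  then obtain h where h: "bij_betw h (W' - W) (W - W')"
    using finite_same_card_bij[of "W' - W" "W - W'"] by auto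
  have "sum t (W' - W) \<le> (\<Sum>x\<in>W' - W. t (h x))"
    using h exch by (intro sum_mono) (auto simp: bij_betw_def)
  also have "\<dots> = sum t (W - W')" using h by (rule sum.reindex_bij_betw)
  finally have "sum t (W' - W) \<le> sum t (W - W')" .
  moreover have "sum t W' = sum t (W' \<inter> W) + sum t (W' - W)"
    by (rule sum.Int_Diff) simp
  moreover have "sum t W = sum t (W' \<inter> W) + sum t (W - W')"
    by (subst sum.Int_Diff[of W t W']) (simp_all add: Int_commute)
  ultimately show "sum t W' \<le> sum t W" by simp
qed

lemma transpose_image_involutory [simp]: "transpose a b ` transpose a b ` W = W"
  by (simp add: image_comp)

lemma card_bij_image: "bij \<tau> \<Longrightarrow> card (\<tau> ` W) = card W"
  by (meson bij_is_inj card_image inj_on_subset subset_UNIV)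

lemma transpose_image_in_committees [simp]:
  "transpose a b ` W \<in> committees k \<longleftrightarrow> W \<in> committees k"
  by (simp add: committees_def card_bij_image)

lemma transpose_image_exchange: "a \<in> W \<Longrightarrow> b \<notin> W \<Longrightarrow> transpose a b ` W = insert b (W - {a})"
  by (auto simp: set_eq_iff in_transpose_image_iff transpose_def)

text \<open>The axioms transported to integer ballot vectors, where subtraction is available.
  Neutrality has pull-back form: composing with \<open>image \<tau>\<close> relabels the candidates
  by the inverse of \<open>\<tau>\<close>.\<close>

locale net_rule =
  fixes k :: nat and g :: "('c::finite set \<Rightarrow> int) \<Rightarrow> 'c set set"
  assumes k_pos: "1 \<le> k" and k_less: "k < card (UNIV :: 'c set)"
    and sub: "g v \<subseteq> committees k" and nonempty: "g v \<noteq> {}"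
    and zero: "g 0 = committees k"
    and add: "g u \<inter> g v \<noteq> {} \<Longrightarrow> g (u + v) = g u \<inter> g v"
    and neutral: "bij \<tau> \<Longrightarrow> g (v \<circ> image \<tau>) = {W. \<tau> ` W \<in> g v}"
    and convex: "\<lbrakk>W \<in> g v; W' \<in> g v; W'' \<in> committees k; W \<inter> W' \<subseteq> W''; W'' \<subseteq> W \<union> W'\<rbrakk> \<Longrightarrow> W'' \<in> g v"
    and continuous: "\<exists>l::nat. 1 \<le> l \<and> g (of_nat l * v + u) \<subseteq> g v"
begin

lemma scale: "1 \<le> n \<Longrightarrow> g (of_nat n * v) = g v"
proof (induction n rule: dec_induct)
  case (step n)
  have "g (v + of_nat n * v) = g v \<inter> g (of_nat n * v)"
    using step nonempty by (intro add) simp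
  moreover have "of_nat (Suc n) * v = v + of_nat n * v" by (simp add: fun_eq_iff pointwise algebra_simps)
  ultimately show ?case using step by (simp only: Int_absorb)
qed simp

text \<open>By consistency these vectors can be added without changing any outcome. They form a
  subgroup, so vectors may be computed modulo \<open>null\<close>.\<close>

definition null :: "('c set \<Rightarrow> int) set" where
  "null = {u. g u = committees k}"

lemma add_null: "u \<in> null \<Longrightarrow> g (v + u) = g v"
  using add[of v u] sub[of v] nonempty[of v] by (auto simp: null_def Int_absorb2)

lemma null_plus: "u \<in> null \<Longrightarrow> v \<in> null \<Longrightarrow> u + v \<in> null"
  using add_null[of v u] by (simp add: null_def)

lemma null_uminus: "u \<in> null \<Longrightarrow> - u \<in> null"
  using add_null[of u "- u"] zero by (simp add: null_def)

lemma null_scale: "u \<in> null \<Longrightarrow> of_int i * u \<in> null"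
proof -
  assume u: "u \<in> null"
  have nat: "of_nat n * u \<in> null" for n
    using u scale[of n u] zero by (cases "n = 0") (auto simp: null_def)
  show ?thesis
  proof (cases i rule: int_cases2)
    case (nonneg n) then show ?thesis using nat[of n] by simp
  next
    case (nonpos n)
    have "of_int i * u = - (of_nat n * u)" using nonpos by (simp add: fun_eq_iff pointwise)
    then show ?thesis using null_uminus[OF nat[of n]] by simp
  qed
qed

lemma null_sum: "(\<And>i. i \<in> I \<Longrightarrow> F i \<in> null) \<Longrightarrow> (\<Sum>i\<in>I. F i) \<in> null"
proof (induction I rule: infinite_finite_induct)
  case (insert x I)
  then show ?case using null_plus[of "F x" "sum F I"] by (simp)
qed (simp_all add: null_def zero)

lemma mem_swap_iff: "W \<in> g (v \<circ> image (transpose a b)) \<longleftrightarrow> transpose a b ` W \<in> g v"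
  by (subst neutral) simp_all

text \<open>Neutrality turns the membership of the swapped committee in \<open>g e\<close> into
  \<open>W \<in> g (- e)\<close>. Consistency then applies to \<open>e + - e = 0\<close>, where all
  committees tie.\<close>

lemma antisymmetric_null:
  assumes "e \<circ> image (transpose a b) = - e" "W \<in> g e" "transpose a b ` W \<in> g e"
  shows "e \<in> null"
proof -
  have "W \<in> g (- e)" using mem_swap_iff[of W e a b] assms by simp
  then have "g (e + - e) = g e \<inter> g (- e)" using assms by (intro add) blast
  then have "committees k \<subseteq> g e" using zero by (simp)
  then show ?thesis using sub[of e] by (auto simp: null_def)
qed

text \<open>This is where choice set convexity enters: it removes every dependence of the outcome on
  correlations between two pairs of candidates inside ballots.\<close>

lemma doubly_antisymmetric_null:
  assumes dist: "distinct [a, b, c, d]"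
    and ab: "e \<circ> image (transpose a b) = - e" and cd: "e \<circ> image (transpose c d) = - e"
  shows "e \<in> null"
proof -
  obtain W where W: "W \<in> g e" using nonempty by blast
  define W' where "W' = transpose c d ` transpose a b ` W"
  \<comment> \<open>The two sign changes cancel, so \<open>e\<close> is invariant under the product
    of the transpositions and \<open>W'\<close> is chosen along with \<open>W\<close>.\<close>
  have "e (transpose a b ` transpose c d ` B) = e B" for B
    using fun_cong[OF ab, of "transpose c d ` B"] fun_cong[OF cd, of B] by (simp add: pointwise)
  then have "(e \<circ> image (transpose a b)) \<circ> image (transpose c d) = e" by (simp add: fun_eq_iff pointwise)
  then have "W \<in> g ((e \<circ> image (transpose a b)) \<circ> image (transpose c d))" using W by simp
  then have W'': "transpose a b ` transpose c d ` W \<in> g e" unfolding mem_swap_iff .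
  have "transpose a b ` transpose c d ` W = W'"
    using dist by (auto simp: W'_def set_eq_iff in_transpose_image_iff transpose_def)
  with W'' have W': "W' \<in> g e" by simp
  show ?thesis
  proof (cases "(a \<in> W \<longleftrightarrow> b \<in> W) \<or> (c \<in> W \<longleftrightarrow> d \<in> W)")
    \<comment> \<open>Here one of the two transpositions fixes \<open>W\<close>.\<close>
    case True
    then show ?thesis using antisymmetric_null[OF ab W] antisymmetric_null[OF cd W] W
      by (auto simp: transpose_image_eq)
  next
    case False
    \<comment> \<open>Now \<open>W\<close> contains exactly one candidate of each pair, and
      \<open>W'\<close> exactly the other one. Replacing the member \<open>y\<close> of the second
      pair by the missing candidate \<open>x\<close> of the first stays between
      \<open>W \<inter> W'\<close> and \<open>W \<union> W'\<close>, and the result contains both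
      \<open>a\<close> and \<open>b\<close>, so it is fixed by their transposition.\<close>
    define x where "x = (if a \<in> W then b else a)"
    define y where "y = (if c \<in> W then c else d)"
    define V where "V = insert x (W - {y})"
    have xy: "x \<notin> W" "y \<in> W" "{a, b} \<subseteq> insert x W" "x \<in> W'" "y \<notin> W'" "y \<noteq> a" "y \<noteq> b"
      using False dist
      by (auto simp: x_def y_def W'_def in_transpose_image_iff transpose_def)
    have "V \<in> g e"
    proof (rule convex[OF W W'])
      show "V \<in> committees k" using W sub[of e] xy unfolding V_def by (blast intro: exchange_in_committees)
    qed (use xy in \<open>auto simp: V_def\<close>)
    moreover have "transpose a b ` V = V"
      using xy by (intro transpose_image_eq) (auto simp: V_def)
    ultimately show ?thesis using antisymmetric_null[OF ab] by simp
  qed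
qed

text \<open>The elementary vectors negated by the transposition; by
  \<open>antisymmetric_eq_sum_swap_diff\<close> they generate all others.\<close>

definition swap_diff :: "'c \<Rightarrow> 'c \<Rightarrow> 'c set \<Rightarrow> 'c set \<Rightarrow> int" where
  "swap_diff a b A B = of_bool (B = A) - of_bool (B = transpose a b ` A)"

lemma eq_transpose_image_iff: "B = transpose a b ` A \<longleftrightarrow> transpose a b ` B = A"
  by (metis transpose_image_involutory)

text \<open>Move \<open>A\<close> towards \<open>A'\<close> by exchanging some
  \<open>c \<in> A - A'\<close> for some \<open>d \<in> A' - A\<close>. The change of
  \<open>swap_diff\<close> in one such move is negated by both transpositions, hence null by
  \<open>doubly_antisymmetric_null\<close>.\<close>

lemma swap_diff_null:
  assumes "a \<noteq> b" "a \<in> A" "b \<notin> A" "a \<in> A'" "b \<notin> A'" "card A = card A'"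
  shows "swap_diff a b A - swap_diff a b A' \<in> null"
  using assms
proof (induction "card (A - A')" arbitrary: A rule: less_induct)
  case less
  show ?case
  proof (cases "A = A'")
    case True
    then show ?thesis by (simp add: null_def zero)
  next
    case False
    have nsub: "\<not> A \<subseteq> A'" "\<not> A' \<subseteq> A"
      using False less.prems by (metis card_subset_eq finite)+
    then obtain c d where c: "c \<in> A" "c \<notin> A'" and d: "d \<in> A'" "d \<notin> A" by blast
    define A1 where "A1 = transpose c d ` A"
    have A1: "A1 = insert d (A - {c})" using c d by (simp add: A1_def transpose_image_exchange)
    have dist: "distinct [a, b, c, d]" using less.prems c d by auto
    have "A1 - A' = (A - A') - {c}" using A1 d by auto
    then have "card (A1 - A') < card (A - A')" using c
      by (metis DiffI card_Diff1_less finite)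
    moreover have "card A1 = card A'" using less.prems by (simp add: A1_def card_bij_image)
    ultimately have IH: "swap_diff a b A1 - swap_diff a b A' \<in> null"
      using less.prems dist A1 by (intro less.hyps) auto
    have comm: "transpose a b ` transpose c d ` B = transpose c d ` transpose a b ` B" for B
      using dist by (auto simp: set_eq_iff in_transpose_image_iff transpose_def)
    have "swap_diff a b A - swap_diff a b A1 \<in> null"
    proof (rule doubly_antisymmetric_null[OF dist])
      show "(swap_diff a b A - swap_diff a b A1) \<circ> image (transpose a b) = - (swap_diff a b A - swap_diff a b A1)"
        by (auto simp: fun_eq_iff pointwise swap_diff_def eq_transpose_image_iff)
      show "(swap_diff a b A - swap_diff a b A1) \<circ> image (transpose c d) = - (swap_diff a b A - swap_diff a b A1)"
        by (auto simp: fun_eq_iff pointwise swap_diff_def eq_transpose_image_iff A1_def comm)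
    qed
    from null_plus[OF this IH] show ?thesis by (simp)
  qed
qed

end

section \<open>Comparing two candidates\<close>

lemma card_separating_sets:
  fixes a b :: "'c::finite"
  assumes "a \<noteq> b" "1 \<le> s"
  shows "card {A. a \<in> A \<and> b \<notin> A \<and> card A = s} = (card (UNIV :: 'c set) - 2) choose (s - 1)"
proof -
  have "bij_betw (insert a) {X. X \<subseteq> UNIV - {a, b} \<and> card X = s - 1} {A. a \<in> A \<and> b \<notin> A \<and> card A = s}"
  proof (rule bij_betwI[where g = "\<lambda>A. A - {a}"])
    show "insert a \<in> {X. X \<subseteq> UNIV - {a, b} \<and> card X = s - 1} \<rightarrow> {A. a \<in> A \<and> b \<notin> A \<and> card A = s}"
    proof
      fix X :: "'c set" assume "X \<in> {X. X \<subseteq> UNIV - {a, b} \<and> card X = s - 1}"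
      then have "a \<notin> X" "b \<notin> X" "card X = s - 1" by auto
      then show "insert a X \<in> {A. a \<in> A \<and> b \<notin> A \<and> card A = s}" using assms by simp
    qed
  qed (use assms in auto)
  then have "card {A. a \<in> A \<and> b \<notin> A \<and> card A = s} = card {X. X \<subseteq> UNIV - {a, b} \<and> card X = s - 1}"
    by (simp add: bij_betw_same_card)
  also have "\<dots> = card (UNIV - {a, b} :: 'c set) choose (s - 1)" by (rule n_subsets) simp
  also have "card (UNIV - {a, b} :: 'c set) = card (UNIV :: 'c set) - 2"
    using assms by (simp add: card_Diff_subset)
  finally show ?thesis .
qed

context net_rule
begin

text \<open>Canonical vectors negated by the transposition of \<open>a\<close> and \<open>b\<close>.
  Unlike \<open>swap_diff\<close> they are invariant under every permutation of the remaining
  candidates.\<close>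

definition pair_vec :: "'c \<Rightarrow> 'c \<Rightarrow> (nat \<Rightarrow> int) \<Rightarrow> 'c set \<Rightarrow> int" where
  "pair_vec a b \<beta> B = \<beta> (card B) * (of_bool (a \<in> B) - of_bool (b \<in> B))"

definition sep :: "'c \<Rightarrow> 'c \<Rightarrow> 'c set set" where
  "sep a b = {W \<in> committees k. a \<in> W \<and> b \<notin> W}"

lemma pair_vec_plus: "pair_vec a b (\<beta> + \<gamma>) = pair_vec a b \<beta> + pair_vec a b \<gamma>"
  by (simp add: fun_eq_iff pointwise pair_vec_def algebra_simps)

lemma pair_vec_uminus: "pair_vec a b (- \<beta>) = - pair_vec a b \<beta>"
  by (simp add: fun_eq_iff pointwise pair_vec_def algebra_simps)

lemma pair_vec_of_nat_mult: "pair_vec a b (of_nat n * \<beta>) = of_nat n * pair_vec a b \<beta>"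
  by (simp add: fun_eq_iff pointwise pair_vec_def algebra_simps)

lemma pair_vec_comp_bij:
  assumes "bij \<sigma>"
  shows "pair_vec (\<sigma> a) (\<sigma> b) \<beta> \<circ> image \<sigma> = pair_vec a b \<beta>"
  using assms by (simp add: fun_eq_iff pair_vec_def card_bij_image bij_is_inj inj_image_mem_iff)

lemma pair_vec_swap: "pair_vec a b \<beta> \<circ> image (transpose a b) = - pair_vec a b \<beta>"
  using pair_vec_comp_bij[of "transpose a b" b a \<beta>]
  by (simp add: fun_eq_iff pointwise pair_vec_def algebra_simps)

lemma sep_nonempty: "a \<noteq> b \<Longrightarrow> sep a b \<noteq> {}"
proof -
  assume ab: "a \<noteq> b"
  then have "k - 1 \<le> card (UNIV - {a, b} :: 'c set)" using k_less by (simp add: card_Diff_subset)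
  then obtain X where X: "X \<subseteq> UNIV - {a, b}" "card X = k - 1" by (rule obtain_subset_with_card_n)
  then have "a \<notin> X" "b \<notin> X" by auto
  then have "insert a X \<in> sep a b" using ab X k_pos by (simp add: sep_def committees_def)
  then show ?thesis by blast
qed

text \<open>\<open>W\<close> and \<open>V\<close> have equally many members besides \<open>a\<close>
  and \<open>b\<close>, so a permutation of the remaining candidates carries one to the other. It
  leaves the vector unchanged, and neutrality applies.\<close>

lemma pair_vec_mem_cong:
  assumes "a \<noteq> b" and W: "W \<in> g (pair_vec a b \<beta>)" and V: "V \<in> committees k"
    and eq: "a \<in> W \<longleftrightarrow> a \<in> V" "b \<in> W \<longleftrightarrow> b \<in> V"
  shows "V \<in> g (pair_vec a b \<beta>)"
proof -
  have "card W = card V" using W V sub[of "pair_vec a b \<beta>"] by (auto simp: committees_def)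
  moreover have "W \<inter> {a, b} = V \<inter> {a, b}" using eq by blast
  moreover have "card (U - {a, b}) = card U - card (U \<inter> {a, b})" for U :: "'c set"
    by (rule card_Diff_subset_Int) simp
  ultimately have "card (W - {a, b}) = card (V - {a, b})" by metis
  then obtain p where p: "p permutes (UNIV - {a, b})" "p ` (W - {a, b}) = V - {a, b}"
    using ex_permutes_image_eq[of "UNIV - {a, b}" "W - {a, b}" "V - {a, b}"] by auto
  have pab: "p a = a" "p b = b" using p(1) by (auto simp: permutes_def)
  have "bij p" using p(1) by (rule permutes_bij)
  from neutral[OF this, of "pair_vec a b \<beta>"] pair_vec_comp_bij[OF this, of a b \<beta>] pab
  have inv: "U \<in> g (pair_vec a b \<beta>) \<longleftrightarrow> p ` U \<in> g (pair_vec a b \<beta>)" for U by auto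
  have "p ` W = p ` (W - {a, b}) \<union> p ` (W \<inter> {a, b})" by blast
  also have "p ` (W \<inter> {a, b}) = V \<inter> {a, b}" using pab eq by auto
  also have "p ` (W - {a, b}) \<union> V \<inter> {a, b} = V" unfolding p(2) by blast
  finally show ?thesis using inv[of W] W by simp
qed

text \<open>Outside \<open>null\<close>, no chosen committee has its swapped image chosen too. So
  each one contains exactly one of \<open>a\<close>, \<open>b\<close>, and by
  \<open>pair_vec_mem_cong\<close> both kinds cannot occur together, while one committee of a kind
  brings in all of that kind.\<close>

lemma pair_vec_cases:
  assumes ab: "a \<noteq> b"
  shows "g (pair_vec a b \<beta>) = committees k \<or> g (pair_vec a b \<beta>) = sep a b \<or> g (pair_vec a b \<beta>) = sep b a"
proof (cases "pair_vec a b \<beta> \<in> null")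
  case True
  then show ?thesis by (simp add: null_def)
next
  case False
  let ?G = "g (pair_vec a b \<beta>)"
  have one: "a \<in> W \<longleftrightarrow> b \<notin> W" if "W \<in> ?G" for W
    using antisymmetric_null[OF pair_vec_swap that] that False transpose_image_eq[of a W b] by metis
  have "\<not> (W \<in> ?G \<and> transpose a b ` W \<in> ?G)" for W
    using antisymmetric_null[OF pair_vec_swap] False by blast
  moreover have "transpose a b ` W \<in> ?G" if "W \<in> sep a b" "V \<in> ?G" "V \<in> sep b a" for V W
    using that ab by (intro pair_vec_mem_cong[OF ab that(2)]) (auto simp: sep_def in_transpose_image_iff)
  ultimately have "\<not> (W \<in> ?G \<and> W \<in> sep a b \<and> V \<in> ?G \<and> V \<in> sep b a)" for V W by blast
  moreover have "?G \<subseteq> sep a b \<union> sep b a"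
    using one sub[of "pair_vec a b \<beta>"] by (auto simp: sep_def)
  ultimately have "?G \<subseteq> sep a b \<or> ?G \<subseteq> sep b a" by blast
  moreover have "sep a b \<subseteq> ?G" if "?G \<subseteq> sep a b"
  proof -
    obtain W where "W \<in> ?G" using nonempty by blast
    then show ?thesis using that pair_vec_mem_cong[OF ab, of W] by (auto simp: sep_def)
  qed
  moreover have "sep b a \<subseteq> ?G" if "?G \<subseteq> sep b a"
  proof -
    obtain W where "W \<in> ?G" using nonempty by blast
    then show ?thesis using that pair_vec_mem_cong[OF ab, of W] by (auto simp: sep_def)
  qed
  ultimately show ?thesis by blast
qed

lemma sep_subset_iff:
  assumes ab: "a \<noteq> b"
  shows "sep a b \<subseteq> g (- pair_vec a b \<beta>) \<longleftrightarrow> sep b a \<subseteq> g (pair_vec a b \<beta>)"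
proof -
  have "g (- pair_vec a b \<beta>) = {W. transpose a b ` W \<in> g (pair_vec a b \<beta>)}"
    using neutral[of "transpose a b" "pair_vec a b \<beta>"] by (simp add: pair_vec_swap)
  moreover have "transpose a b ` W \<in> sep b a \<longleftrightarrow> W \<in> sep a b" for W
    using ab by (auto simp: sep_def in_transpose_image_iff)
  ultimately show ?thesis by (smt (verit) mem_Collect_eq subset_eq transpose_image_involutory)
qed

lemma sep_distinct:
  assumes "a \<noteq> b"
  shows "\<not> sep a b \<subseteq> sep b a" "\<not> committees k \<subseteq> sep a b"
  using sep_nonempty[of a b] sep_nonempty[of b a] assms unfolding sep_def by blast+

text \<open>The preorder is studied on one fixed pair \<open>p\<close>, \<open>q\<close>; neutrality
  carries the result to every pair, so a single \<open>\<phi>\<close> serves all of them.\<close>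

lemma pair_functional:
  obtains \<phi> :: "(nat \<Rightarrow> int) \<Rightarrow> real"
  where "\<And>\<beta> \<gamma>. \<phi> (\<beta> + \<gamma>) = \<phi> \<beta> + \<phi> \<gamma>"
    and "\<And>a b \<beta>. a \<noteq> b \<Longrightarrow> 0 < \<phi> \<beta> \<Longrightarrow> g (pair_vec a b \<beta>) = sep a b"
    and "\<And>a b \<beta>. a \<noteq> b \<Longrightarrow> \<phi> \<beta> = 0 \<Longrightarrow> g (pair_vec a b \<beta>) = committees k"
proof -
  have "\<exists>p q :: 'c. p \<noteq> q"
  proof (rule ccontr)
    assume "\<nexists>p q :: 'c. p \<noteq> q"
    then have "(UNIV :: 'c set) = {undefined}" by auto
    then have "card (UNIV :: 'c set) = 1" by (metis is_singletonI is_singleton_altdef)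
    then show False using k_pos k_less by simp
  qed
  then obtain p q :: 'c where pq: "p \<noteq> q" by blast
  \<comment> \<open>The vectors that weakly prefer \<open>p\<close> to \<open>q\<close>. By
    \<open>sep_subset_iff\<close>, \<open>- \<beta> \<in> Q\<close> expresses the opposite weak
    preference under \<open>\<beta>\<close>.\<close>
  define Q where "Q = {\<beta>. sep p q \<subseteq> g (pair_vec p q \<beta>)}"
  have strict: "g (pair_vec p q \<beta>) = sep p q" if "- \<beta> \<notin> Q" for \<beta>
  proof -
    have "\<not> sep q p \<subseteq> g (pair_vec p q \<beta>)"
      using that sep_subset_iff[OF pq] by (simp add: Q_def pair_vec_uminus)
    moreover have "sep q p \<subseteq> committees k" by (auto simp: sep_def)
    ultimately show ?thesis using pair_vec_cases[OF pq, of \<beta>] by auto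
  qed
  obtain \<phi> :: "(nat \<Rightarrow> int) \<Rightarrow> real"
    where additive: "\<And>x y. \<phi> (x + y) = \<phi> x + \<phi> y" and Q_iff: "\<And>x. x \<in> Q \<longleftrightarrow> 0 \<le> \<phi> x"
  proof (rule archimedean_preorder_functional[of Q])
    fix \<beta> \<gamma> assume "\<beta> \<in> Q" "\<gamma> \<in> Q"
    then have "sep p q \<subseteq> g (pair_vec p q \<beta>) \<inter> g (pair_vec p q \<gamma>)" by (auto simp: Q_def)
    moreover from this have "g (pair_vec p q \<beta>) \<inter> g (pair_vec p q \<gamma>) \<noteq> {}"
      using sep_nonempty[OF pq] by blast
    ultimately show "\<beta> + \<gamma> \<in> Q" by (simp add: Q_def pair_vec_plus add)
  next
    fix \<beta> show "\<beta> \<in> Q \<or> - \<beta> \<in> Q" using strict[of \<beta>] by (auto simp: Q_def)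
  next
    fix \<beta> \<gamma> assume "- \<beta> \<notin> Q"
    then have eq: "g (pair_vec p q \<beta>) = sep p q" by (rule strict)
    \<comment> \<open>Continuity lets many copies of a strict preference override
      \<open>\<gamma>\<close>; among the three possible outcomes only \<open>sep p q\<close> is
      contained in \<open>sep p q\<close>.\<close>
    obtain l where l: "g (of_nat l * pair_vec p q \<beta> + pair_vec p q \<gamma>) \<subseteq> g (pair_vec p q \<beta>)"
      using continuous by blast
    then have "g (pair_vec p q (of_nat l * \<beta> + \<gamma>)) \<subseteq> sep p q"
      by (simp only: eq pair_vec_plus pair_vec_of_nat_mult)
    then have "g (pair_vec p q (of_nat l * \<beta> + \<gamma>)) = sep p q"
      using pair_vec_cases[OF pq, of "of_nat l * \<beta> + \<gamma>"] sep_distinct pq by metis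
    then show "\<exists>n. of_nat n * \<beta> + \<gamma> \<in> Q" unfolding Q_def by (intro exI[of _ l]) simp
  next
    fix \<phi>' :: "(nat \<Rightarrow> int) \<Rightarrow> real"
    assume "\<And>x y. \<phi>' (x + y) = \<phi>' x + \<phi>' y" "\<And>x. x \<in> Q \<longleftrightarrow> 0 \<le> \<phi>' x"
    then show thesis by (rule that)
  qed
  have neg: "\<phi> (- \<beta>) = - \<phi> \<beta>" for \<beta>
    using additive[of \<beta> "- \<beta>"] additive[of 0 0] by simp
  have transfer: "g (pair_vec a b \<beta>) = {W. \<sigma> ` W \<in> g (pair_vec p q \<beta>)}"
    if "bij \<sigma>" "\<sigma> a = p" "\<sigma> b = q" for \<sigma> a b \<beta>
    using neutral[OF that(1), of "pair_vec p q \<beta>"] pair_vec_comp_bij[OF that(1), of a b \<beta>] that by simp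
  have ex: "\<exists>\<sigma>. bij \<sigma> \<and> \<sigma> a = p \<and> \<sigma> b = q" if "a \<noteq> b" for a b :: 'c
  proof -
    \<comment> \<open>First \<open>a\<close> is sent to \<open>p\<close>, then the image of
      \<open>b\<close> to \<open>q\<close>. The second transposition does not move \<open>p\<close>,
      as neither of its points is \<open>p\<close>.\<close>
    let ?r = "transpose a p"
    let ?\<sigma> = "transpose (?r b) q \<circ> ?r"
    have "bij ?\<sigma>" by (intro bij_comp) simp_all
    moreover have "?\<sigma> b = q" by simp
    moreover have "?r b \<noteq> p" using that by (metis transpose_apply_second transpose_involutory)
    then have "?\<sigma> a = p" using pq by (simp add: transpose_def)
    ultimately show ?thesis by blast
  qed
  show ?thesis
  proof
    show "\<phi> (\<beta> + \<gamma>) = \<phi> \<beta> + \<phi> \<gamma>" for \<beta> \<gamma> by (rule additive)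
  next
    fix a b :: 'c and \<beta> assume ab: "a \<noteq> b" and pos: "0 < \<phi> \<beta>"
    obtain \<sigma> where \<sigma>: "bij \<sigma>" "\<sigma> a = p" "\<sigma> b = q" using ex[OF ab] by blast
    have "g (pair_vec p q \<beta>) = sep p q" using pos by (intro strict) (simp add: Q_iff neg)
    moreover have "\<sigma> ` W \<in> sep p q \<longleftrightarrow> W \<in> sep a b" for W
      using inj_image_mem_iff[OF bij_is_inj[OF \<sigma>(1)]] \<sigma>
      by (simp add: sep_def committees_def card_bij_image flip: \<sigma>(2,3))
    ultimately show "g (pair_vec a b \<beta>) = sep a b"
      using transfer[OF \<sigma>, of \<beta>] by simp
  next
    fix a b :: 'c and \<beta> assume ab: "a \<noteq> b" and zero: "\<phi> \<beta> = 0"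
    obtain \<sigma> where \<sigma>: "bij \<sigma>" "\<sigma> a = p" "\<sigma> b = q" using ex[OF ab] by blast
    have "\<beta> \<in> Q" "- \<beta> \<in> Q" using zero by (simp_all add: Q_iff neg)
    then have "sep p q \<subseteq> g (pair_vec p q \<beta>)" "sep q p \<subseteq> g (pair_vec p q \<beta>)"
      using sep_subset_iff[OF pq] by (auto simp: Q_def pair_vec_uminus)
    then have "g (pair_vec p q \<beta>) = committees k"
      using pair_vec_cases[OF pq, of \<beta>] sep_distinct pq by metis
    then show "g (pair_vec a b \<beta>) = committees k"
      using transfer[OF \<sigma>, of \<beta>] \<sigma> by (auto simp: committees_def card_bij_image)
  qed
qed

end

section \<open>Representation by ballot size weights\<close>

definition weighted_score :: "(nat \<Rightarrow> real) \<Rightarrow> ('c::finite set \<Rightarrow> int) \<Rightarrow> 'c set \<Rightarrow> real" where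
  "weighted_score \<alpha> v W = (\<Sum>B\<in>UNIV. real_of_int (v B) * (\<alpha> (card B) * real (card (B \<inter> W))))"

definition candidate_score :: "(nat \<Rightarrow> real) \<Rightarrow> ('c::finite set \<Rightarrow> int) \<Rightarrow> 'c \<Rightarrow> real" where
  "candidate_score \<alpha> v c = (\<Sum>B | c \<in> B. real_of_int (v B) * \<alpha> (card B))"

text \<open>Counting \<open>B \<inter> W\<close> member by member makes the score additive over the
  committee, the form required by \<open>best_committee_iff\<close>.\<close>

lemma weighted_score_eq_sum: "weighted_score \<alpha> v W = (\<Sum>c\<in>W. candidate_score \<alpha> v c)"
proof -
  have "weighted_score \<alpha> v W = (\<Sum>B\<in>UNIV. \<Sum>c\<in>W. if c \<in> B then real_of_int (v B) * \<alpha> (card B) else 0)"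
    unfolding weighted_score_def
    by (intro sum.cong refl) (simp add: sum.If_cases Int_commute)
  also have "\<dots> = (\<Sum>c\<in>W. \<Sum>B\<in>UNIV. if c \<in> B then real_of_int (v B) * \<alpha> (card B) else 0)"
    by (rule sum.swap)
  also have "\<dots> = (\<Sum>c\<in>W. candidate_score \<alpha> v c)"
    unfolding candidate_score_def by (rule sum.cong[OF refl]) (simp add: sum.If_cases)
  finally show ?thesis .
qed

context net_rule
begin

text \<open>Each ballot of size \<open>s\<close> separating two candidates is, modulo \<^const>\<open>null\<close>, a fraction
  \<open>1 / ballot_multiplicity s\<close> of \<^const>\<open>pair_vec\<close>; the common multiple clears these denominators.\<close>

definition ballot_multiplicity :: "nat \<Rightarrow> nat" where
  "ballot_multiplicity s = (card (UNIV :: 'c set) - 2) choose (s - 1)"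

definition common_multiple :: nat where
  "common_multiple = (\<Prod>s\<in>{1..<card (UNIV :: 'c set)}. ballot_multiplicity s)"

text \<open>Sets of any other size separate no two candidates, hence the value 0. It also gives
  \<open>swap_weights\<close> the finite support that \<open>additive_functional_sum\<close> asks
  for.\<close>

definition cofactor :: "nat \<Rightarrow> int" where
  "cofactor s = (if s \<in> {1..<card (UNIV :: 'c set)} then int (common_multiple div ballot_multiplicity s) else 0)"

text \<open>Up to the factor \<open>common_multiple\<close>, the approval surplus of
  \<open>b\<close> over \<open>a\<close> at size \<open>s\<close> divided by
  \<open>ballot_multiplicity s\<close>; the cofactor keeps it integral.\<close>

definition swap_weights :: "'c \<Rightarrow> 'c \<Rightarrow> ('c set \<Rightarrow> int) \<Rightarrow> nat \<Rightarrow> int" where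
  "swap_weights a b v s = cofactor s *
     ((\<Sum>A | b \<in> A \<and> card A = s. v A) - (\<Sum>A | a \<in> A \<and> card A = s. v A))"

lemma common_multiple_pos: "1 \<le> common_multiple"
proof -
  have "0 < common_multiple"
    unfolding common_multiple_def ballot_multiplicity_def by (intro prod_pos) auto
  then show ?thesis by simp
qed

lemma cofactor_mult:
  "s \<in> {1..<card (UNIV :: 'c set)} \<Longrightarrow> cofactor s * int (ballot_multiplicity s) = int common_multiple"
  unfolding cofactor_def common_multiple_def
  by (simp flip: of_nat_mult add: dvd_prodI)

text \<open>Summing \<open>swap_diff\<close> over all sets of this size that contain
  \<open>a\<close> but not \<open>b\<close> gives the canonical vector of that size, and by
  \<open>swap_diff_null\<close> all summands agree modulo \<open>null\<close>.\<close>

lemma swap_diff_equiv_pair_vec: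
  assumes ab: "a \<noteq> b" and A: "a \<in> A" "b \<notin> A"
  shows "of_int (int (ballot_multiplicity (card A))) * swap_diff a b A
    - pair_vec a b (\<lambda>s. of_bool (s = card A)) \<in> null"
proof -
  define \<A> where "\<A> = {A'. a \<in> A' \<and> b \<notin> A' \<and> card A' = card A}"
  have "1 \<le> card A" using A by (metis One_nat_def Suc_leI card_gt_0_iff empty_iff finite)
  then have card: "card \<A> = ballot_multiplicity (card A)"
    unfolding \<A>_def ballot_multiplicity_def by (rule card_separating_sets[OF ab])
  have "(\<Sum>A'\<in>\<A>. swap_diff a b A' B) = pair_vec a b (\<lambda>s. of_bool (s = card A)) B" for B
  proof -
    have "(\<Sum>A'\<in>\<A>. swap_diff a b A' B) =
        (\<Sum>A'\<in>\<A>. if A' = B then 1 else 0) - (\<Sum>A'\<in>\<A>. if A' = transpose a b ` B then 1 else 0)"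
      unfolding sum_subtractf[symmetric] swap_diff_def eq_transpose_image_iff
      by (intro sum.cong refl) auto
    also have "\<dots> = of_bool (B \<in> \<A>) - of_bool (transpose a b ` B \<in> \<A>)"
      by (simp add: of_bool_def)
    also have "\<dots> = pair_vec a b (\<lambda>s. of_bool (s = card A)) B"
      using ab by (auto simp: \<A>_def pair_vec_def card_bij_image in_transpose_image_iff)
    finally show ?thesis .
  qed
  then have "of_int (int (ballot_multiplicity (card A))) * swap_diff a b A
      - pair_vec a b (\<lambda>s. of_bool (s = card A)) = (\<Sum>A'\<in>\<A>. swap_diff a b A - swap_diff a b A')"
    by (simp add: fun_eq_iff pointwise sum_fun_apply sum_subtractf card)
  also have "\<dots> \<in> null"
    using ab A by (intro null_sum swap_diff_null) (auto simp: \<A>_def)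
  finally show ?thesis .
qed

text \<open>Sets containing \<open>a\<close> but not \<open>b\<close> represent the two-element
  orbits of the transposition; on its fixed points \<open>d\<close> vanishes.\<close>

lemma antisymmetric_eq_sum_swap_diff:
  assumes ab: "a \<noteq> b" and anti: "d \<circ> image (transpose a b) = - d"
  shows "d B = (\<Sum>A | a \<in> A \<and> b \<notin> A. d A * swap_diff a b A B)"
proof -
  let ?S = "{A. a \<in> A \<and> b \<notin> A}"
  have neg: "d (transpose a b ` B) = - d B" using fun_cong[OF anti, of B] by (simp add: pointwise)
  have "(\<Sum>A\<in>?S. d A * swap_diff a b A B)
      = (\<Sum>A\<in>?S. if A = B then d A else 0) - (\<Sum>A\<in>?S. if A = transpose a b ` B then d A else 0)"
    unfolding sum_subtractf[symmetric] swap_diff_def eq_transpose_image_iff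
    by (intro sum.cong refl) auto
  also have "\<dots> = (if B \<in> ?S then d B else 0) - (if transpose a b ` B \<in> ?S then d (transpose a b ` B) else 0)"
    by simp
  also have "\<dots> = d B"
  proof (cases "a \<in> B \<longleftrightarrow> b \<in> B")
    case True
    then have "transpose a b ` B = B" by simp
    then have "d B = 0" using neg by simp
    then show ?thesis using True by (auto simp: in_transpose_image_iff)
  next
    case False
    then show ?thesis using neg by (auto simp: in_transpose_image_iff)
  qed
  finally show ?thesis by simp
qed

text \<open>Expand the difference in elementary vectors and replace each by its canonical
  counterpart. Multiplying by \<open>common_multiple\<close>, which is cofactor times multiplicity
  at every relevant size, makes this possible over the integers.\<close>

lemma swap_equiv_pair_vec:
  assumes ab: "a \<noteq> b"
  shows "of_nat common_multiple * ((v \<circ> image (transpose a b)) - v)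
    - pair_vec a b (swap_weights a b v) \<in> null"
proof -
  define d where "d = (v \<circ> image (transpose a b)) - v"
  define S where "S = {A. a \<in> A \<and> b \<notin> A}"
  let ?e = "\<lambda>A. pair_vec a b (\<lambda>s. of_bool (s = card A))"
  have anti: "d \<circ> image (transpose a b) = - d" by (simp add: d_def fun_eq_iff pointwise)
  have range: "card A \<in> {1..<card (UNIV :: 'c set)}" if "A \<in> S" for A
  proof -
    have "A \<noteq> {}" "A \<subset> UNIV" using that by (auto simp: S_def)
    then show ?thesis using psubset_card_mono[of UNIV A] card_gt_0_iff[of A] by simp
  qed
  \<comment> \<open>Reindexing by the transposition turns the swapped part into a sum over sets with
    \<open>b\<close> and without \<open>a\<close>. Sets containing both candidates cancel in the
    approval surplus.\<close>
  have weights: "cofactor s * (\<Sum>A | A \<in> S \<and> card A = s. d A) = swap_weights a b v s" for s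
  proof -
    have "(\<Sum>A | A \<in> S \<and> card A = s. v (transpose a b ` A)) = (\<Sum>A | b \<in> A \<and> a \<notin> A \<and> card A = s. v A)"
      by (rule sum.reindex_bij_witness[of _ "image (transpose a b)" "image (transpose a b)"])
        (auto simp: S_def in_transpose_image_iff card_bij_image)
    moreover have "(\<Sum>A | x \<in> A \<and> card A = s. v A)
        = (\<Sum>A | x \<in> A \<and> y \<notin> A \<and> card A = s. v A) + (\<Sum>A | x \<in> A \<and> y \<in> A \<and> card A = s. v A)" for x y
      by (subst sum.union_disjoint[symmetric]) (auto intro!: sum.cong)
    from this[of a b] this[of b a]
    have "(\<Sum>A | b \<in> A \<and> card A = s. v A) - (\<Sum>A | a \<in> A \<and> card A = s. v A)
        = (\<Sum>A | b \<in> A \<and> a \<notin> A \<and> card A = s. v A) - (\<Sum>A | a \<in> A \<and> b \<notin> A \<and> card A = s. v A)"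
      by (simp add: conj_left_commute)
    ultimately show ?thesis
      by (simp add: swap_weights_def d_def pointwise sum_subtractf S_def)
  qed
  have "of_nat common_multiple * d - pair_vec a b (swap_weights a b v)
      = (\<Sum>A\<in>S. of_int (d A * cofactor (card A)) *
          (of_int (int (ballot_multiplicity (card A))) * swap_diff a b A - ?e A))"
  proof
    fix B
    have "(\<Sum>A\<in>S. d A * cofactor (card A) * (int (ballot_multiplicity (card A)) * swap_diff a b A B - ?e A B))
       = (\<Sum>A\<in>S. d A * (cofactor (card A) * int (ballot_multiplicity (card A))) * swap_diff a b A B)
         - (\<Sum>A\<in>S. d A * cofactor (card A) * ?e A B)"
      by (simp add: sum_subtractf algebra_simps)
    also have "(\<Sum>A\<in>S. d A * (cofactor (card A) * int (ballot_multiplicity (card A))) * swap_diff a b A B)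
        = (\<Sum>A\<in>S. int common_multiple * (d A * swap_diff a b A B))"
      using range by (intro sum.cong refl) (simp add: cofactor_mult algebra_simps)
    also have "\<dots> = int common_multiple * d B"
      using antisymmetric_eq_sum_swap_diff[OF ab anti, of B] by (simp add: S_def sum_distrib_left)
    also have "(\<Sum>A\<in>S. d A * cofactor (card A) * ?e A B)
        = (\<Sum>A\<in>S. if card A = card B then cofactor (card B) * d A * (of_bool (a \<in> B) - of_bool (b \<in> B)) else 0)"
      by (intro sum.cong refl) (auto simp: pair_vec_def)
    also have "\<dots> = (\<Sum>A | A \<in> S \<and> card A = card B. cofactor (card B) * d A * (of_bool (a \<in> B) - of_bool (b \<in> B)))"
      by (subst sum.inter_filter[symmetric]) (auto simp: S_def)
    also have "\<dots> = pair_vec a b (swap_weights a b v) B"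
      by (simp add: pair_vec_def weights[symmetric] sum_distrib_left sum_distrib_right)
    finally show "(of_nat common_multiple * d - pair_vec a b (swap_weights a b v)) B
        = (\<Sum>A\<in>S. of_int (d A * cofactor (card A)) *
            (of_int (int (ballot_multiplicity (card A))) * swap_diff a b A - ?e A)) B"
      by (simp add: pointwise sum_fun_apply)
  qed
  also have "\<dots> \<in> null"
    using ab by (intro null_sum null_scale swap_diff_equiv_pair_vec) (auto simp: S_def)
  finally show ?thesis by (simp add: d_def)
qed

lemma swap_eq_add_pair_vec:
  assumes "a \<noteq> b"
  shows "g (v \<circ> image (transpose a b)) = g (of_nat common_multiple * v + pair_vec a b (swap_weights a b v))"
    (is "_ = g ?w")
proof -
  let ?n = "of_nat common_multiple * ((v \<circ> image (transpose a b)) - v) - pair_vec a b (swap_weights a b v)"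
  have "g (v \<circ> image (transpose a b)) = g (of_nat common_multiple * (v \<circ> image (transpose a b)))"
    using scale[OF common_multiple_pos] by simp
  also have "of_nat common_multiple * (v \<circ> image (transpose a b)) = ?w + ?n"
    by (simp add: algebra_simps)
  also have "g (?w + ?n) = g ?w" by (rule add_null[OF swap_equiv_pair_vec[OF assms]])
  finally show ?thesis .
qed

theorem weighted_representation:
  obtains \<alpha> :: "nat \<Rightarrow> real"
  where "\<And>s. s \<notin> {1..<card (UNIV :: 'c set)} \<Longrightarrow> \<alpha> s = 0"
    and "\<And>v. g v = {W \<in> committees k. \<forall>W'\<in>committees k. weighted_score \<alpha> v W' \<le> weighted_score \<alpha> v W}"
proof -
  obtain \<phi> :: "(nat \<Rightarrow> int) \<Rightarrow> real"
    where additive: "\<And>\<beta> \<gamma>. \<phi> (\<beta> + \<gamma>) = \<phi> \<beta> + \<phi> \<gamma>"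
      and pos: "\<And>a b \<beta>. a \<noteq> b \<Longrightarrow> 0 < \<phi> \<beta> \<Longrightarrow> g (pair_vec a b \<beta>) = sep a b"
      and null: "\<And>a b \<beta>. a \<noteq> b \<Longrightarrow> \<phi> \<beta> = 0 \<Longrightarrow> g (pair_vec a b \<beta>) = committees k"
    using pair_functional by blast
  \<comment> \<open>The cofactor is absorbed into the weight, so that \<open>\<phi>\<close> of
    \<open>swap_weights a b v\<close> becomes exactly the score difference of \<open>b\<close> and
    \<open>a\<close>.\<close>
  define \<alpha> where "\<alpha> s = real_of_int (cofactor s) * \<phi> (\<lambda>t. of_bool (t = s))" for s
  let ?m = "card (UNIV :: 'c set)"
  let ?t = "candidate_score \<alpha>"
  have \<alpha>_zero: "\<alpha> s = 0" if "s \<notin> {1..<?m}" for s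
    using that by (auto simp: \<alpha>_def cofactor_def)
  have score: "?t v c = (\<Sum>s\<in>{1..<?m}. \<alpha> s * real_of_int (\<Sum>A | c \<in> A \<and> card A = s. v A))" for v c
  proof -
    have "(\<Sum>s\<in>{1..<?m}. \<alpha> s * real_of_int (\<Sum>A | c \<in> A \<and> card A = s. v A))
        = (\<Sum>s\<in>{1..<?m}. \<Sum>A | c \<in> A. if s = card A then real_of_int (v A) * \<alpha> (card A) else 0)"
    proof (intro sum.cong refl)
      fix s
      have "(\<Sum>A | c \<in> A. if s = card A then real_of_int (v A) * \<alpha> (card A) else 0)
          = (\<Sum>A | c \<in> A \<and> card A = s. real_of_int (v A) * \<alpha> s)"
        by (subst sum.inter_filter[symmetric]) (auto intro!: sum.cong)
      then show "\<alpha> s * real_of_int (\<Sum>A | c \<in> A \<and> card A = s. v A)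
          = (\<Sum>A | c \<in> A. if s = card A then real_of_int (v A) * \<alpha> (card A) else 0)"
        by (simp add: sum_distrib_left mult.commute)
    qed
    also have "\<dots> = (\<Sum>A | c \<in> A. \<Sum>s\<in>{1..<?m}. if s = card A then real_of_int (v A) * \<alpha> (card A) else 0)"
      by (rule sum.swap)
    also have "\<dots> = ?t v c"
      unfolding candidate_score_def using \<alpha>_zero by (intro sum.cong refl) auto
    finally show ?thesis by simp
  qed
  have diff: "\<phi> (swap_weights a b v) = ?t v b - ?t v a" for a b v
  proof -
    have "\<phi> (swap_weights a b v)
        = (\<Sum>s\<in>{1..<?m}. real_of_int (swap_weights a b v s) * \<phi> (\<lambda>t. of_bool (t = s)))"
      by (rule additive_functional_sum) (auto simp: additive swap_weights_def cofactor_def)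
    also have "\<dots> = ?t v b - ?t v a"
      unfolding score sum_subtractf[symmetric]
      by (intro sum.cong refl) (simp add: swap_weights_def \<alpha>_def algebra_simps)
    finally show ?thesis .
  qed
  \<comment> \<open>If \<open>b\<close> scored more, consistency at \<open>W\<close> would confine
    the outcome of the swapped vector to \<open>sep a b\<close>. But neutrality puts the swapped
    \<open>W\<close> into that outcome, and it contains \<open>b\<close> and not
    \<open>a\<close>.\<close>
  have exchange: "?t v b \<le> ?t v a" if W: "W \<in> g v" "a \<in> W" "b \<notin> W" for v W a b
  proof (rule ccontr)
    assume "\<not> ?t v b \<le> ?t v a"
    then have sep: "g (pair_vec a b (swap_weights a b v)) = sep a b"
      using W by (intro pos) (auto simp: diff)
    have ab: "a \<noteq> b" using W by auto
    have gv: "g (of_nat common_multiple * v) = g v" by (rule scale[OF common_multiple_pos])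
    have "W \<in> sep a b" using W sub[of v] by (auto simp: sep_def)
    then have "g (v \<circ> image (transpose a b)) = g v \<inter> sep a b"
      unfolding swap_eq_add_pair_vec[OF ab] using W by (subst add) (auto simp: gv sep)
    moreover have "transpose a b ` W \<in> g (v \<circ> image (transpose a b))"
      using W by (simp add: mem_swap_iff)
    ultimately have "transpose a b ` W \<in> sep a b" by blast
    then show False using W by (simp add: sep_def in_transpose_image_iff)
  qed
  have tie: "transpose a b ` W \<in> g v" if W: "W \<in> g v" and ab: "a \<noteq> b" and eq: "?t v a = ?t v b" for v W a b
  proof -
    have "g (pair_vec a b (swap_weights a b v)) = committees k"
      using ab eq by (intro null) (auto simp: diff)
    then have "g (v \<circ> image (transpose a b)) = g v"
      unfolding swap_eq_add_pair_vec[OF ab]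
      by (subst add_null) (simp_all add: null_def scale[OF common_multiple_pos])
    then show ?thesis using W mem_swap_iff by blast
  qed
  have best: "W \<in> g v" if W: "W \<in> committees k"
      and opt: "\<forall>a\<in>W. \<forall>b. b \<notin> W \<longrightarrow> ?t v b \<le> ?t v a" for v W
  proof -
    \<comment> \<open>A chosen committee closest to \<open>W\<close>. If it differs from
      \<open>W\<close>, then \<open>exchange\<close> and the optimality of \<open>W\<close> force a
      tie between a member to drop and one to gain, and \<open>tie\<close> produces a chosen
      committee closer to \<open>W\<close>.\<close>
    define V where "V = arg_min_on (\<lambda>V. card (W - V)) (g v)"
    have V: "V \<in> g v" unfolding V_def by (rule arg_min_if_finite(1)) (simp_all add: nonempty)
    have min: "card (W - V) \<le> card (W - U)" if "U \<in> g v" for U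
      unfolding V_def using that by (intro arg_min_least) (simp_all add: nonempty)
    have "W = V"
    proof (rule ccontr)
      assume "W \<noteq> V"
      moreover have "card W = card V" using V W sub[of v] by (auto simp: committees_def)
      ultimately have "\<not> W \<subseteq> V" "\<not> V \<subseteq> W" by (metis card_subset_eq finite)+
      then obtain a b where a: "a \<in> V" "a \<notin> W" and b: "b \<in> W" "b \<notin> V" by blast
      have "?t v a = ?t v b" using exchange[OF V a(1) b(2)] opt a b by (meson antisym)
      then have U: "transpose a b ` V \<in> g v" using V a b by (intro tie) auto
      have "W - transpose a b ` V = (W - V) - {b}"
        using a b by (subst transpose_image_exchange) auto
      then have "card (W - transpose a b ` V) < card (W - V)"
        using b by (metis DiffI card_Diff1_less finite)
      then show False using min[OF U] by simp
    qed
    then show ?thesis using V by simp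
  qed
  have "g v = {W \<in> committees k. \<forall>W'\<in>committees k. weighted_score \<alpha> v W' \<le> weighted_score \<alpha> v W}" for v
  proof (intro set_eqI iffI)
    fix W assume W: "W \<in> g v"
    then have "W \<in> committees k" using sub by blast
    with best_committee_iff[OF this, of "?t v"] exchange[OF W]
    show "W \<in> {W \<in> committees k. \<forall>W'\<in>committees k. weighted_score \<alpha> v W' \<le> weighted_score \<alpha> v W}"
      by (simp add: weighted_score_eq_sum)
  next
    fix W assume "W \<in> {W \<in> committees k. \<forall>W'\<in>committees k. weighted_score \<alpha> v W' \<le> weighted_score \<alpha> v W}"
    then show "W \<in> g v"
      using best_committee_iff[of W k "?t v"] by (intro best) (simp_all add: weighted_score_eq_sum)
  qed
  with \<alpha>_zero show ?thesis by (rule that)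
qed

end

section \<open>Profiles and their ballot counts\<close>

text \<open>Integer-valued, so that counts are vectors in the sense of
  \<open>net_rule\<close>.\<close>

definition ballot_count :: "'c profile \<Rightarrow> 'c set \<Rightarrow> int" where
  "ballot_count A B = int (card {i. A i = Some B})"

lemma is_profile_iff:
  "is_profile A \<longleftrightarrow> finite (dom A) \<and> dom A \<noteq> {} \<and> 0 \<notin> dom A \<and> (\<forall>i. A i \<noteq> Some {})"
proof -
  have "(\<forall>i\<in>dom A. the (A i) \<noteq> {}) \<longleftrightarrow> (\<forall>i. A i \<noteq> Some {})"
    by (force simp: dom_def)
  then show ?thesis by (simp add: is_profile_def)
qed

lemma finite_voters: "finite (dom A) \<Longrightarrow> finite {i. A i = Some B}"
  by (rule finite_subset[of _ "dom A"]) auto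

lemma ballot_count_empty: "is_profile A \<Longrightarrow> ballot_count A {} = 0"
  by (simp add: is_profile_iff ballot_count_def)

lemma sum_dom_eq_sum_ballots:
  fixes A :: "'c::finite profile" and h :: "'c set \<Rightarrow> 'b::comm_ring_1"
  assumes "finite (dom A)"
  shows "(\<Sum>i\<in>dom A. h (the (A i))) = (\<Sum>B\<in>UNIV. of_int (ballot_count A B) * h B)"
proof -
  have "(\<Sum>i\<in>dom A. h (the (A i))) = (\<Sum>B\<in>UNIV. \<Sum>i | i \<in> dom A \<and> the (A i) = B. h (the (A i)))"
    using assms by (intro sum.group[symmetric]) auto
  also have "\<dots> = (\<Sum>B\<in>UNIV. \<Sum>i | A i = Some B. h B)"
    by (intro sum.cong refl) auto
  finally show ?thesis by (simp add: ballot_count_def)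
qed

lemma bswav_score_eq_weighted_score:
  fixes A :: "'c::finite profile"
  assumes "is_profile A"
  shows "bswav_score \<alpha> A W = weighted_score \<alpha> (ballot_count A) W"
  using sum_dom_eq_sum_ballots[of A "\<lambda>B. \<alpha> (card B) * real (card (B \<inter> W))"] assms
  by (simp add: bswav_score_def weighted_score_def is_profile_def)

lemma weighted_score_plus: "weighted_score \<alpha> (u + v) W = weighted_score \<alpha> u W + weighted_score \<alpha> v W"
  by (simp add: weighted_score_def pointwise sum.distrib algebra_simps)

lemma weighted_score_of_nat_mult: "weighted_score \<alpha> (of_nat l * v) W = real l * weighted_score \<alpha> v W"
  by (simp add: weighted_score_def pointwise sum_distrib_left algebra_simps)

lemma weighted_score_comp_bij:
  assumes "bij \<tau>"
  shows "weighted_score \<alpha> (v \<circ> image \<tau>) W = weighted_score \<alpha> v (\<tau> ` W)"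
proof -
  have "bij (image \<tau>)" using assms by (simp add: bij_betw_Pow flip: Pow_UNIV)
  then have "weighted_score \<alpha> v (\<tau> ` W)
      = (\<Sum>B\<in>UNIV. real_of_int (v (\<tau> ` B)) * (\<alpha> (card (\<tau> ` B)) * real (card (\<tau> ` B \<inter> \<tau> ` W))))"
    unfolding weighted_score_def by (intro sum.reindex_bij_betw[symmetric])
  also have "\<dots> = weighted_score \<alpha> (v \<circ> image \<tau>) W"
    using assms unfolding weighted_score_def
    by (simp add: card_bij_image bij_is_inj flip: image_Int)
  finally show ?thesis by simp
qed

lemma is_profile_map_add: "is_profile A \<Longrightarrow> is_profile A' \<Longrightarrow> is_profile (A ++ A')"
  by (simp add: is_profile_iff map_add_Some_iff)

lemma ballot_count_map_add:
  assumes "is_profile A" "is_profile A'" "disjoint_profiles A A'"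
  shows "ballot_count (A ++ A') = ballot_count A + ballot_count A'"
proof
  fix B
  have "{i. (A ++ A') i = Some B} = {i. A i = Some B} \<union> {i. A' i = Some B}"
    using assms(3) by (auto simp: disjoint_profiles_def map_add_Some_iff)
  moreover have "{i. A i = Some B} \<inter> {i. A' i = Some B} = {}"
    using assms(3) by (auto simp: disjoint_profiles_def)
  ultimately show "ballot_count (A ++ A') B = (ballot_count A + ballot_count A') B"
    using assms by (simp add: ballot_count_def pointwise is_profile_def card_Un_disjoint finite_voters)
qed

lemma dom_rename_cands: "dom (rename_cands \<tau> A) = dom A"
  by (auto simp: rename_cands_def dom_def)

lemma is_profile_rename_cands: "is_profile A \<Longrightarrow> is_profile (rename_cands \<tau> A)"
  by (auto simp: is_profile_iff dom_rename_cands) (auto simp: rename_cands_def)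

lemma ballot_count_rename_cands:
  assumes "bij \<tau>"
  shows "ballot_count (rename_cands \<tau> A) \<circ> image \<tau> = ballot_count A"
proof
  fix B
  have "{i. rename_cands \<tau> A i = Some (\<tau> ` B)} = {i. A i = Some B}"
    using assms by (auto simp: rename_cands_def inj_image_eq_iff bij_is_inj)
  then show "(ballot_count (rename_cands \<tau> A) \<circ> image \<tau>) B = ballot_count A B"
    by (simp add: ballot_count_def)
qed

lemma rename_voters_apply:
  assumes "inj_on \<pi> (dom A)" "i \<in> dom A"
  shows "rename_voters \<pi> A (\<pi> i) = A i"
  using assms by (simp add: rename_voters_def)

lemma dom_rename_voters: "inj_on \<pi> (dom A) \<Longrightarrow> dom (rename_voters \<pi> A) = \<pi> ` dom A"
  by (auto simp: rename_voters_def dom_def split: if_splits)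

lemma voter_perm_inj_on: "voter_perm \<pi> \<Longrightarrow> is_profile A \<Longrightarrow> inj_on \<pi> (dom A)"
  by (rule inj_on_subset[of _ "{0<..}"]) (auto simp: voter_perm_def bij_betw_def is_profile_def intro!: gr0I)

lemma ballot_count_rename_voters:
  assumes "voter_perm \<pi>" "is_profile A"
  shows "ballot_count (rename_voters \<pi> A) = ballot_count A"
proof
  fix B
  have inj: "inj_on \<pi> (dom A)" using assms by (rule voter_perm_inj_on)
  have "{j. rename_voters \<pi> A j = Some B} = \<pi> ` {i. A i = Some B}"
  proof (intro set_eqI iffI)
    fix j assume j: "j \<in> {j. rename_voters \<pi> A j = Some B}"
    then have "j \<in> \<pi> ` dom A" using dom_rename_voters[OF inj] by blast
    then obtain i where i: "i \<in> dom A" "j = \<pi> i" by blast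
    then have "A i = Some B" using j rename_voters_apply[OF inj i(1)] by simp
    then show "j \<in> \<pi> ` {i. A i = Some B}" using i by blast
  next
    fix j assume "j \<in> \<pi> ` {i. A i = Some B}"
    then obtain i where i: "A i = Some B" "j = \<pi> i" by blast
    then show "j \<in> {j. rename_voters \<pi> A j = Some B}" using rename_voters_apply[OF inj, of i] by (simp add: domI)
  qed
  moreover have "inj_on \<pi> {i. A i = Some B}" using inj by (rule inj_on_subset) auto
  ultimately show "ballot_count (rename_voters \<pi> A) B = ballot_count A B"
    by (simp add: ballot_count_def card_image)
qed

lemma is_profile_rename_voters:
  assumes "voter_perm \<pi>" "is_profile A"
  shows "is_profile (rename_voters \<pi> A)"
proof -
  have inj: "inj_on \<pi> (dom A)" using assms by (rule voter_perm_inj_on)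
  have "\<pi> i \<noteq> 0" if "i \<in> dom A" for i
  proof -
    have "i \<in> {0<..}" using that assms(2) by (auto simp: is_profile_def intro!: gr0I)
    then have "\<pi> i \<in> {0<..}" using assms(1) unfolding voter_perm_def by (rule bij_betw_apply[rotated])
    then show ?thesis by simp
  qed
  then have "0 \<notin> \<pi> ` dom A" by force
  moreover have "\<forall>j\<in>\<pi> ` dom A. the (rename_voters \<pi> A j) \<noteq> {}"
    using assms(2) by (simp add: rename_voters_apply[OF inj] is_profile_def)
  ultimately show ?thesis
    using assms(2) unfolding is_profile_def dom_rename_voters[OF inj] by simp
qed

lemma copies_is_profile:
  assumes A: "is_profile A" and l: "1 \<le> l" and B: "copies l A B"
  shows "is_profile B"
proof -
  obtain \<sigma> where pos: "\<forall>j<l. \<sigma> j ` dom A \<subseteq> {0<..}" and dom: "dom B = (\<Union>j<l. \<sigma> j ` dom A)"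
    and eq: "\<forall>j<l. \<forall>i\<in>dom A. B (\<sigma> j i) = A i"
    using B unfolding copies_def by metis
  have "finite (dom B)" "0 \<notin> dom B" unfolding dom using A pos by (auto simp: is_profile_def)
  moreover have "dom B \<noteq> {}" unfolding dom using A l by (auto simp: is_profile_def intro!: exI[of _ 0])
  moreover have "the (B x) \<noteq> {}" if x: "x \<in> dom B" for x
  proof -
    from x obtain j i where "j < l" "i \<in> dom A" "x = \<sigma> j i" unfolding dom by blast
    then show ?thesis using eq A by (simp add: is_profile_def)
  qed
  ultimately show ?thesis by (simp add: is_profile_def)
qed

lemma copies_ballot_count:
  assumes A: "is_profile A" and B: "copies l A B"
  shows "ballot_count B = of_nat l * ballot_count A"
proof
  fix C
  obtain \<sigma> where inj: "\<forall>j<l. inj_on (\<sigma> j) (dom A)"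
    and disj: "\<forall>j<l. \<forall>j'<l. j \<noteq> j' \<longrightarrow> \<sigma> j ` dom A \<inter> \<sigma> j' ` dom A = {}"
    and dom: "dom B = (\<Union>j<l. \<sigma> j ` dom A)"
    and eq: "\<forall>j<l. \<forall>i\<in>dom A. B (\<sigma> j i) = A i"
    using B unfolding copies_def by metis
  let ?V = "{i. A i = Some C}"
  have sub: "?V \<subseteq> dom A" by auto
  have "{x. B x = Some C} = (\<Union>j<l. \<sigma> j ` ?V)"
  proof (intro set_eqI iffI)
    fix x assume x: "x \<in> {x. B x = Some C}"
    then have "x \<in> dom B" by auto
    then obtain j i where "j < l" "i \<in> dom A" "x = \<sigma> j i" unfolding dom by blast
    then show "x \<in> (\<Union>j<l. \<sigma> j ` ?V)" using x eq by auto
  next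
    fix x assume "x \<in> (\<Union>j<l. \<sigma> j ` ?V)"
    then obtain j i where "j < l" "A i = Some C" "x = \<sigma> j i" by blast
    then show "x \<in> {x. B x = Some C}" using eq by (simp add: domI)
  qed
  also have "card \<dots> = (\<Sum>j<l. card (\<sigma> j ` ?V))"
  proof (rule card_UN_disjoint)
    show "\<forall>j\<in>{..<l}. \<forall>j'\<in>{..<l}. j \<noteq> j' \<longrightarrow> \<sigma> j ` ?V \<inter> \<sigma> j' ` ?V = {}"
    proof (intro ballI impI)
      fix j j' assume "j \<in> {..<l}" "j' \<in> {..<l}" "j \<noteq> j'"
      then have "\<sigma> j ` dom A \<inter> \<sigma> j' ` dom A = {}" using disj by simp
      moreover have "\<sigma> j ` ?V \<subseteq> \<sigma> j ` dom A" "\<sigma> j' ` ?V \<subseteq> \<sigma> j' ` dom A"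
        using sub by (intro image_mono; assumption)+
      ultimately show "\<sigma> j ` ?V \<inter> \<sigma> j' ` ?V = {}" by blast
    qed
  qed (use A in \<open>auto simp: is_profile_def finite_voters\<close>)
  also have "\<dots> = (\<Sum>j<l. card ?V)"
    using inj sub by (intro sum.cong refl card_image) (auto intro: inj_on_subset)
  finally show "ballot_count B C = (of_nat l * ballot_count A) C"
    by (simp add: ballot_count_def pointwise)
qed

lemma ex_copies:
  obtains B where "copies l A B" "dom B \<subseteq> {N<..}"
proof
  \<comment> \<open>The pairing function keeps the copies disjoint, and the shift places them beyond
    \<open>N\<close>, away from any given finite electorate.\<close>
  define \<sigma> where "\<sigma> j i = Suc N + prod_encode (j, i)" for j i
  define B where "B x = (if N < x \<and> fst (prod_decode (x - Suc N)) < l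
    then A (snd (prod_decode (x - Suc N))) else None)" for x
  have val: "B (\<sigma> j i) = (if j < l then A i else None)" for j i
    by (simp add: B_def \<sigma>_def)
  have ex: "\<exists>j i. x = \<sigma> j i" if "N < x" for x
  proof -
    obtain j i where ji: "prod_decode (x - Suc N) = (j, i)" by fastforce
    then have "prod_encode (j, i) = x - Suc N" by (metis prod_decode_inverse)
    then show ?thesis using that by (intro exI[of _ j] exI[of _ i]) (simp add: \<sigma>_def)
  qed
  show dom_N: "dom B \<subseteq> {N<..}" by (auto simp: B_def split: if_splits)
  have "dom B = (\<Union>j<l. \<sigma> j ` dom A)"
  proof (intro set_eqI iffI)
    fix x assume x: "x \<in> dom B"
    then obtain j i where ji: "x = \<sigma> j i" using ex dom_N by blast
    then have "j < l" "i \<in> dom A" using x val[of j i] by (auto simp: dom_def split: if_splits)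
    then show "x \<in> (\<Union>j<l. \<sigma> j ` dom A)" using ji by blast
  qed (auto simp: val)
  moreover have "inj_on (\<sigma> j) X" for j X by (auto simp: \<sigma>_def inj_on_def)
  moreover have "\<sigma> j ` X \<inter> \<sigma> j' ` X = {}" if "j \<noteq> j'" for j j' X
    using that by (auto simp: \<sigma>_def)
  moreover have "\<sigma> j ` X \<subseteq> {0<..}" for j X by (auto simp: \<sigma>_def)
  ultimately show "copies l A B" unfolding copies_def
    by (intro exI[of _ \<sigma>] conjI allI impI ballI) (simp_all add: val)
qed

lemma ex_profile_with_counts:
  fixes n :: "'c::finite set \<Rightarrow> nat"
  assumes "n {} = 0" "n B0 \<noteq> 0"
  obtains A where "is_profile A" "dom A \<subseteq> {N<..}" "\<And>B. ballot_count A B = int (n B)"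
proof -
  \<comment> \<open>One pair for each required occurrence of a ballot; \<open>e\<close> numbers
    these pairs by the voters just above \<open>N\<close>.\<close>
  define D where "D = Sigma UNIV (\<lambda>B. {..<n B})"
  have fin: "finite D" by (simp add: D_def)
  then obtain e where e: "bij_betw e D {N<..N + card D}"
    using finite_same_card_bij[of D "{N<..N + card D}"] by auto
  define A where "A i = (if i \<in> {N<..N + card D} then Some (fst (inv_into D e i)) else None)" for i
  have inv: "inv_into D e (e d) = d" if "d \<in> D" for d
    using e that by (simp add: bij_betw_inv_into_left)
  have img: "e ` D = {N<..N + card D}" using e by (simp add: bij_betw_def)
  have dom: "dom A = {N<..N + card D}" by (auto simp: A_def split: if_splits)
  have Ae: "A (e d) = Some (fst d)" if "d \<in> D" for d
    using that img inv by (auto simp: A_def)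
  have count: "card {i. A i = Some B} = n B" for B
  proof -
    have "{i. A i = Some B} = e ` ({B} \<times> {..<n B})"
    proof (intro set_eqI iffI)
      fix i assume i: "i \<in> {i. A i = Some B}"
      then have "i \<in> e ` D" using dom img by auto
      then obtain d where "d \<in> D" "i = e d" by blast
      then show "i \<in> e ` ({B} \<times> {..<n B})" using i Ae[of d] by (cases d) (auto simp: D_def)
    next
      fix i assume "i \<in> e ` ({B} \<times> {..<n B})"
      then show "i \<in> {i. A i = Some B}" using Ae by (auto simp: D_def)
    qed
    moreover have "inj_on e ({B} \<times> {..<n B})"
      using bij_betw_imp_inj_on[OF e] by (rule inj_on_subset) (auto simp: D_def)
    ultimately show ?thesis by (simp add: card_image card_cartesian_product)
  qed
  have "{i. A i = Some {}} = {}"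
    using count[of "{}"] assms(1) finite_voters[of A "{}"] dom by simp
  moreover have "{i. A i = Some B0} \<noteq> {}" using count[of B0] assms(2) by (metis card.empty)
  then have "dom A \<noteq> {}" by auto
  ultimately have "is_profile A" unfolding is_profile_iff using dom by auto
  then show ?thesis by (rule that) (simp_all add: dom count ballot_count_def subset_iff)
qed

text \<open>The electorates may differ, whereas anonymity speaks of permutations of all voters. On
  the union \<open>S\<close> both profiles are total functions with \<open>None\<close> for absence;
  their values form the same multiset, so a permutation of \<open>S\<close> relates them, extended
  by the identity.\<close>

lemma anonymous_ballot_count:
  fixes A A' :: "'c::finite profile"
  assumes anon: "anonymous f" and A: "is_profile A" and A': "is_profile A'"
    and eq: "ballot_count A = ballot_count A'"
  shows "f A = f A'"
proof -
  define S where "S = dom A \<union> dom A'"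
  have fin: "finite S" "finite (dom A)" "finite (dom A')"
    using A A' by (auto simp: S_def is_profile_def)
  have "int (card (dom A)) = int (card (dom A'))"
    using sum_dom_eq_sum_ballots[OF fin(2), of "\<lambda>_. 1 :: int"]
      sum_dom_eq_sum_ballots[OF fin(3), of "\<lambda>_. 1 :: int"] eq by simp
  then have card_dom: "card (S - dom A) = card (S - dom A')"
    using fin by (simp add: card_Diff_subset S_def)
  have "image_mset A (mset_set S) = image_mset A' (mset_set S)"
  proof (rule multiset_eqI)
    fix x
    have count: "count (image_mset P (mset_set S)) x = card {i \<in> S. P i = x}" for P :: "'c profile"
    proof -
      have "count (image_mset P (mset_set S)) x = (\<Sum>i\<in>P -` {x} \<inter> S. 1)"
        using fin by (auto simp: count_image_mset intro!: sum.cong)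
      also have "P -` {x} \<inter> S = {i \<in> S. P i = x}" by auto
      finally show ?thesis by simp
    qed
    have "card {i \<in> S. A i = x} = card {i \<in> S. A' i = x}"
    proof (cases x)
      case None
      then have "{i \<in> S. A i = x} = S - dom A" "{i \<in> S. A' i = x} = S - dom A'" by auto
      then show ?thesis using card_dom by simp
    next
      case (Some B)
      then have "{i \<in> S. A i = x} = {i. A i = Some B}" "{i \<in> S. A' i = x} = {i. A' i = Some B}"
        by (auto simp: S_def)
      then show ?thesis using fun_cong[OF eq, of B] by (simp add: ballot_count_def)
    qed
    then show "count (image_mset A (mset_set S)) x = count (image_mset A' (mset_set S)) x"
      by (simp add: count)
  qed
  then obtain p where p: "p permutes S" and Ap: "\<forall>i\<in>S. A i = A' (p i)"
    using image_mset_eq_implies_permutes[OF fin(1)] by metis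
  have "S \<subseteq> {0<..}" using A A' by (auto simp: S_def is_profile_def intro!: gr0I)
  then have "p permutes {0<..}" using p by (rule permutes_subset[rotated])
  then have perm: "voter_perm p" by (simp add: voter_perm_def permutes_imp_bij)
  have inj: "inj_on p (dom A)" using perm A by (rule voter_perm_inj_on)
  have out: "A i = A' (p i)" for i
  proof (cases "i \<in> S")
    case False
    then have "p i = i" using p by (simp add: permutes_def)
    then show ?thesis using False by (auto simp: S_def dom_def)
  qed (use Ap in blast)
  have "rename_voters p A = A'"
  proof
    fix j
    obtain i where j: "j = p i" using p by (metis permutes_surj surjD)
    show "rename_voters p A j = A' j"
    proof (cases "i \<in> dom A")
      case True
      then show ?thesis using rename_voters_apply[OF inj] out j by simp
    next
      case False
      then have "j \<notin> p ` dom A" using j p by (metis image_iff permutes_inj injD)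
      then have "rename_voters p A j = None" by (simp add: rename_voters_def)
      then show ?thesis using False out[of i] j by (simp add: domIff)
    qed
  qed
  then show ?thesis using anon A perm unfolding anonymous_def by metis
qed

section \<open>The axioms characterize BSWAV rules\<close>

text \<open>The surplus \<open>n\<close> makes up for negative entries. The value of
  \<open>v\<close> at the empty set is left open because the empty set is not a ballot.\<close>

definition represents :: "'c profile \<Rightarrow> ('c set \<Rightarrow> int) \<Rightarrow> nat \<Rightarrow> bool" where
  "represents A v n \<longleftrightarrow> is_profile A \<and> (\<forall>B. B \<noteq> {} \<longrightarrow> ballot_count A B = v B + int n)"

text \<open>Adding each ballot equally often does not change the outcome, so a rule extends to
  ballot vectors with negative entries.\<close>

definition net :: "('c profile \<Rightarrow> 'c set set) \<Rightarrow> ('c set \<Rightarrow> int) \<Rightarrow> 'c set set" where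
  "net f v = f (SOME A. \<exists>n. represents A v n)"

lemma ex_represents:
  fixes v :: "'c::finite set \<Rightarrow> int"
  assumes "\<And>B. 0 < v B + int n"
  obtains A where "represents A v n" "dom A \<subseteq> {N<..}"
proof (rule ex_profile_with_counts[of "\<lambda>B. if B = {} then 0 else nat (v B + int n)" UNIV N])
  fix A assume "is_profile A" "dom A \<subseteq> {N<..}"
    "\<And>B. ballot_count A B = int (if B = {} then 0 else nat (v B + int n))"
  moreover have "0 \<le> v B + int n" for B using assms[of B] by simp
  ultimately show thesis by (intro that[of A]) (simp_all add: represents_def)
qed (use assms[of UNIV] in auto)

lemma ex_represents_beyond:
  fixes v :: "'c::finite set \<Rightarrow> int"
  obtains A n where "represents A v n" "dom A \<subseteq> {N<..}"
proof -
  \<comment> \<open>Large enough to make every entry strictly positive, so that the electorate is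
    non-empty.\<close>
  define n where "n = Suc (nat (\<Sum>B\<in>UNIV. \<bar>v B\<bar>))"
  have "0 < v B + int n" for B
  proof -
    have "\<bar>v B\<bar> \<le> (\<Sum>B\<in>UNIV. \<bar>v B\<bar>)" by (rule member_le_sum) auto
    then show ?thesis by (simp add: n_def)
  qed
  then show ?thesis using ex_represents that by metis
qed

lemma disjoint_beyond:
  assumes "is_profile A"
  obtains N where "\<And>A'. dom A' \<subseteq> {N<..} \<Longrightarrow> disjoint_profiles A A' \<and> disjoint_profiles A' A"
proof -
  have "finite (dom A)" using assms by (simp add: is_profile_def)
  then obtain N where "\<forall>i\<in>dom A. i \<le> N" using finite_nat_set_iff_bounded_le by blast
  then have "disjoint_profiles A A' \<and> disjoint_profiles A' A" if "dom A' \<subseteq> {N<..}" for A' :: "'a profile"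
    using that unfolding disjoint_profiles_def by (meson disjoint_iff greaterThan_iff leD subsetD)
  then show ?thesis by (rule that)
qed

lemma represents_map_add:
  assumes "represents A v n" "represents A' u n'" "disjoint_profiles A A'"
  shows "represents (A ++ A') (v + u) (n + n')"
  using assms by (simp add: represents_def is_profile_map_add ballot_count_map_add pointwise)

lemma represents_ballot_count: "is_profile A \<Longrightarrow> represents A (ballot_count A) 0"
  by (simp add: represents_def)

section \<open>From the axioms to ballot size weights\<close>

locale axiomatic_rule =
  fixes f :: "('c::finite) profile \<Rightarrow> 'c set set" and k :: nat
  assumes k_pos: "1 \<le> k" and k_less: "k < card (UNIV :: 'c set)"
    and abc: "abc_rule k f" and anonymous: "anonymous f" and neutral: "neutral f"
    and consistent: "consistent f" and continuous: "continuous_rule f"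
    and convex: "choice_set_convex k f" and efficient: "weakly_efficient f"
begin

lemma f_sub: "is_profile A \<Longrightarrow> f A \<subseteq> committees k"
  and f_nonempty: "is_profile A \<Longrightarrow> f A \<noteq> {}"
  using abc by (auto simp: abc_rule_def)

lemma f_add:
  "\<lbrakk>is_profile A; is_profile A'; disjoint_profiles A A'; f A \<inter> f A' \<noteq> {}\<rbrakk> \<Longrightarrow> f (A ++ A') = f A \<inter> f A'"
  using consistent by (simp add: consistent_def)

lemma f_cong_counts:
  assumes "is_profile A" "is_profile A'" "\<And>B. B \<noteq> {} \<Longrightarrow> ballot_count A B = ballot_count A' B"
  shows "f A = f A'"
proof (rule anonymous_ballot_count[OF anonymous assms(1,2)], rule ext)
  show "ballot_count A B = ballot_count A' B" for B
    using assms by (cases "B = {}") (simp_all add: ballot_count_empty)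
qed

lemma represents_rename_cands:
  assumes \<tau>: "bij \<tau>" and A: "represents A (v \<circ> image \<tau>) n"
  shows "represents (rename_cands \<tau> A) v n"
proof -
  have "ballot_count (rename_cands \<tau> A) B = v B + int n" if "B \<noteq> {}" for B
  proof -
    obtain C where C: "B = \<tau> ` C" using \<tau> by (metis bij_is_surj surj_image_vimage_eq)
    then show ?thesis
      using that A fun_cong[OF ballot_count_rename_cands[OF \<tau>, of A], of C] by (simp add: represents_def)
  qed
  then show ?thesis using A by (simp add: represents_def is_profile_rename_cands)
qed

text \<open>Renaming candidates preserves the counts of such a profile, so its outcome is invariant
  under all permutations of candidates, and these act transitively on committees of size
  \<open>k\<close>.\<close>

lemma f_uniform:
  assumes A: "represents A 0 n"
  shows "f A = committees k"
proof
  have prof: "is_profile A" using A by (simp add: represents_def)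
  show "f A \<subseteq> committees k" by (rule f_sub[OF prof])
  obtain W where W: "W \<in> f A" using f_nonempty[OF prof] by blast
  show "committees k \<subseteq> f A"
  proof
    fix V :: "'c set" assume "V \<in> committees k"
    then have "card W = card V" using W f_sub[OF prof] by (auto simp: committees_def)
    then obtain \<tau> where \<tau>: "\<tau> permutes UNIV" "\<tau> ` W = V"
      using ex_permutes_image_eq[of UNIV W V] by auto
    have bij: "bij \<tau>" using \<tau>(1) by (rule permutes_bij)
    have "represents A (0 \<circ> image \<tau>) n" using A by (simp add: represents_def pointwise)
    then have "represents (rename_cands \<tau> A) 0 n" by (rule represents_rename_cands[OF bij])
    then have "f (rename_cands \<tau> A) = f A"
      using A by (intro f_cong_counts) (simp_all add: represents_def)
    moreover have "f (rename_cands \<tau> A) = image \<tau> ` f A"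
      using neutral prof bij by (simp add: neutral_def)
    ultimately show "V \<in> f A" using W \<tau>(2) by blast
  qed
qed

text \<open>Padding with uniform profiles brings both surpluses to \<open>n + n' + 1\<close>;
  consistency with \<open>f_uniform\<close> keeps the outcomes. The successor makes sure that the
  padding profile is non-empty.\<close>

lemma f_cong_represents:
  assumes A: "represents A v n" and A': "represents A' v n'"
  shows "f A = f A'"
proof -
  have add_uniform: "\<exists>C. represents C v (i + Suc j) \<and> f C = f D" if D: "represents D v i" for D i j
  proof -
    have prof: "is_profile D" using D by (simp add: represents_def)
    obtain N where N: "\<And>C. dom C \<subseteq> {N<..} \<Longrightarrow> disjoint_profiles D C \<and> disjoint_profiles C D"
      using disjoint_beyond[OF prof] by blast
    have "0 < (0 :: 'c set \<Rightarrow> int) B + int (Suc j)" for B by (simp add: pointwise)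
    then obtain E where E: "represents E (0 :: 'c set \<Rightarrow> int) (Suc j)" "dom E \<subseteq> {N<..}"
      using ex_represents by metis
    have "represents (D ++ E) (v + 0) (i + Suc j)"
      using represents_map_add[OF D E(1)] N[OF E(2)] by blast
    moreover have "f (D ++ E) = f D \<inter> f E"
      using D E N[OF E(2)] f_uniform[OF E(1)] f_sub[OF prof] f_nonempty[OF prof]
      by (intro f_add) (auto simp: represents_def)
    then have "f (D ++ E) = f D" using f_uniform[OF E(1)] f_sub[OF prof] by blast
    ultimately show ?thesis by auto
  qed
  obtain C where C: "represents C v (n + Suc n')" "f C = f A" using add_uniform[OF A] by blast
  obtain C' where C': "represents C' v (n' + Suc n)" "f C' = f A'" using add_uniform[OF A'] by blast
  have "f C = f C'" using C C' by (intro f_cong_counts) (simp_all add: represents_def)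
  then show ?thesis using C C' by simp
qed

lemma net_eq:
  assumes A: "represents A v n"
  shows "net f v = f A"
proof -
  have "\<exists>n. represents (SOME A. \<exists>n. represents A v n) v n"
    using A by (intro someI_ex[of "\<lambda>A. \<exists>n. represents A v n"]) blast
  then show ?thesis unfolding net_def using f_cong_represents[OF _ A] by blast
qed

text \<open>Every law is verified on representing profiles with disjoint electorates, whose vectors
  and surpluses both add up.\<close>

sublocale net_rule k "net f"
proof
  fix u v :: "'c set \<Rightarrow> int"
  obtain A n where A: "represents A v n" using ex_represents_beyond by metis
  then have prof: "is_profile A" by (simp add: represents_def)
  show "net f v \<subseteq> committees k" "net f v \<noteq> {}"
    using f_sub[OF prof] f_nonempty[OF prof] by (simp_all add: net_eq[OF A])
  obtain N where N: "\<And>A'. dom A' \<subseteq> {N<..} \<Longrightarrow> disjoint_profiles A A' \<and> disjoint_profiles A' A"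
    using disjoint_beyond[OF prof] by blast
  obtain A' n' where A': "represents A' u n'" "dom A' \<subseteq> {N<..}" using ex_represents_beyond by metis
  then have prof': "is_profile A'" by (simp add: represents_def)
  show "net f (u + v) = net f u \<inter> net f v" if "net f u \<inter> net f v \<noteq> {}"
  proof -
    have disj: "disjoint_profiles A' A" using N[OF A'(2)] by blast
    have "net f (u + v) = f (A' ++ A)" by (rule net_eq[OF represents_map_add[OF A'(1) A disj]])
    then show ?thesis
      using f_add[OF prof' prof disj] that by (simp add: net_eq[OF A] net_eq[OF A'(1)])
  qed
  show "W'' \<in> net f v" if "W \<in> net f v" "W' \<in> net f v" "W'' \<in> committees k" "W \<inter> W' \<subseteq> W''" "W'' \<subseteq> W \<union> W'"
    for W W' W''
    using convex prof that unfolding choice_set_convex_def net_eq[OF A] by blast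
  show "\<exists>l::nat. 1 \<le> l \<and> net f (of_nat l * v + u) \<subseteq> net f v"
  proof -
    obtain l :: nat where l: "1 \<le> l"
      and cont: "\<And>B. copies l A B \<Longrightarrow> disjoint_profiles B A' \<Longrightarrow> f (B ++ A') \<subseteq> f A"
      using continuous prof prof' unfolding continuous_rule_def by blast
    obtain N' where N': "\<And>B. dom B \<subseteq> {N'<..} \<Longrightarrow> disjoint_profiles A' B \<and> disjoint_profiles B A'"
      using disjoint_beyond[OF prof'] by blast
    obtain B where B: "copies l A B" "dom B \<subseteq> {N'<..}" using ex_copies by blast
    have disj: "disjoint_profiles B A'" using N'[OF B(2)] by blast
    have "represents B (of_nat l * v) (l * n)"
      using A copies_is_profile[OF prof l B(1)] copies_ballot_count[OF prof B(1)]
      by (simp add: represents_def pointwise algebra_simps)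
    from net_eq[OF represents_map_add[OF this A'(1) disj]] cont[OF B(1) disj] l
    show ?thesis by (intro exI[of _ l]) (simp add: net_eq[OF A])
  qed
next
  fix v :: "'c set \<Rightarrow> int" and \<tau> :: "'c \<Rightarrow> 'c" assume \<tau>: "bij \<tau>"
  obtain A n where A: "represents A (v \<circ> image \<tau>) n" using ex_represents_beyond by metis
  then have "f (rename_cands \<tau> A) = image \<tau> ` f A"
    using neutral \<tau> by (simp add: neutral_def represents_def)
  then have "net f v = image \<tau> ` net f (v \<circ> image \<tau>)"
    using net_eq[OF A] net_eq[OF represents_rename_cands[OF \<tau> A]] by simp
  then show "net f (v \<circ> image \<tau>) = {W. \<tau> ` W \<in> net f v}"
    using \<tau> by (auto simp: inj_image_eq_iff bij_is_inj)
next
  obtain A n where A: "represents A (0 :: 'c set \<Rightarrow> int) n" using ex_represents_beyond by metis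
  then show "net f 0 = committees k" using f_uniform net_eq by metis
qed (rule k_pos k_less)+

lemma is_bswav: "is_bswav k f"
proof -
  obtain \<alpha> :: "nat \<Rightarrow> real" where zero: "\<And>s. s \<notin> {1..<card (UNIV :: 'c set)} \<Longrightarrow> \<alpha> s = 0"
    and rep: "\<And>v. net f v = {W \<in> committees k. \<forall>W'\<in>committees k. weighted_score \<alpha> v W' \<le> weighted_score \<alpha> v W}"
    using weighted_representation by blast
  have f_eq: "f A = {W \<in> committees k. \<forall>W'\<in>committees k. weighted_score \<alpha> (ballot_count A) W' \<le> weighted_score \<alpha> (ballot_count A) W}"
    if "is_profile A" for A
    using net_eq[OF represents_ballot_count[OF that]] rep by simp
  have "0 \<le> \<alpha> s" for s
  proof (rule ccontr)
    assume neg: "\<not> 0 \<le> \<alpha> s"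
    then have s: "1 \<le> s" "s < card (UNIV :: 'c set)" using zero[of s] by auto
    then have "s \<le> card (UNIV :: 'c set)" by simp
    then obtain B :: "'c set" where B: "card B = s" by (rule obtain_subset_with_card_n)
    \<comment> \<open>A single ballot of the size with negative weight: approved candidates score
      below all others, so a chosen committee takes one only if it contains every candidate outside
      \<open>B\<close>.\<close>
    define A :: "'c profile" where "A = [1 \<mapsto> B]"
    have "B \<noteq> {}" "B \<noteq> UNIV" using B s by auto
    then have prof: "is_profile A" by (auto simp: A_def is_profile_def)
    have count: "ballot_count A C = of_bool (C = B)" for C
    proof -
      have "{i. A i = Some C} = (if C = B then {1} else {})" by (auto simp: A_def)
      then show ?thesis by (simp add: ballot_count_def)
    qed
    have score: "candidate_score \<alpha> (ballot_count A) c = (if c \<in> B then \<alpha> s else 0)" for c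
    proof -
      have "candidate_score \<alpha> (ballot_count A) c = (\<Sum>C | c \<in> C. if C = B then \<alpha> s else 0)"
        unfolding candidate_score_def count using B by (intro sum.cong) auto
      then show ?thesis by simp
    qed
    have opt: "\<not> (a \<in> B \<and> b \<notin> B)" if "W \<in> f A" "a \<in> W" "b \<notin> W" for W a b
    proof -
      have W: "W \<in> committees k" using that f_sub[OF prof] by blast
      have "candidate_score \<alpha> (ballot_count A) b \<le> candidate_score \<alpha> (ballot_count A) a"
        using best_committee_iff[OF W, of "candidate_score \<alpha> (ballot_count A)"] that
        by (simp add: f_eq[OF prof] weighted_score_eq_sum)
      then show ?thesis using neg by (auto simp: score split: if_splits)
    qed
    obtain W where W: "W \<in> f A" using f_nonempty[OF prof] by blast
    then have "card W = k" using f_sub[OF prof] by (auto simp: committees_def)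
    then have "W \<noteq> {}" "W \<noteq> UNIV" using k_pos k_less by auto
    \<comment> \<open>If \<open>W\<close> meets \<open>B\<close>, then by \<open>opt\<close> every
      candidate outside \<open>W\<close> lies in \<open>B\<close>, and a candidate outside
      \<open>B\<close> must be in \<open>W\<close>. Weak efficiency will then replace the unapproved
      \<open>c\<close> by the approved \<open>c'\<close>, against \<open>opt\<close>.\<close>
    then have "\<exists>c c'. c \<in> W \<and> c \<notin> B \<and> c' \<notin> W \<and> c' \<in> B"
    proof (cases "W \<inter> B = {}")
      case True
      then show ?thesis using \<open>W \<noteq> {}\<close> \<open>B \<noteq> {}\<close> by blast
    next
      case False
      then obtain a where "a \<in> W" "a \<in> B" by blast
      then have "b \<in> B" if "b \<notin> W" for b using opt[OF W _ that] by blast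
      then show ?thesis using \<open>W \<noteq> UNIV\<close> \<open>B \<noteq> UNIV\<close> by blast
    qed
    then obtain c c' where c: "c \<in> W" "c \<notin> B" "c' \<notin> W" "c' \<in> B" by blast
    have "(\<Union>i\<in>dom A. the (A i)) = B" by (simp add: A_def)
    then have "(W \<union> {c'}) - {c} \<in> f A"
      using efficient prof W c unfolding weakly_efficient_def by blast
    from opt[OF this, of c' c] show False using c by auto
  qed
  then show ?thesis
    unfolding is_bswav_def using f_eq by (intro exI[of _ \<alpha>]) (simp add: bswav_score_eq_weighted_score)
qed

end

section \<open>From ballot size weights to the axioms\<close>

locale bswav_rule =
  fixes f :: "('c::finite) profile \<Rightarrow> 'c set set" and k :: nat and \<alpha> :: "nat \<Rightarrow> real"
  assumes nonneg: "\<And>s. 0 \<le> \<alpha> s"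
    and f_eq: "\<And>A. is_profile A \<Longrightarrow> f A = {W \<in> committees k. \<forall>W'\<in>committees k.
      weighted_score \<alpha> (ballot_count A) W' \<le> weighted_score \<alpha> (ballot_count A) W}"
    and abc: "abc_rule k f"
begin

lemma mem_iff_exchange:
  assumes "is_profile A"
  shows "W \<in> f A \<longleftrightarrow> W \<in> committees k \<and>
    (\<forall>a\<in>W. \<forall>b. b \<notin> W \<longrightarrow> candidate_score \<alpha> (ballot_count A) b \<le> candidate_score \<alpha> (ballot_count A) a)"
proof (cases "W \<in> committees k")
  case True
  then show ?thesis
    unfolding f_eq[OF assms] weighted_score_eq_sum
    using best_committee_iff[OF True, of "candidate_score \<alpha> (ballot_count A)"] by simp
qed (simp add: f_eq[OF assms])

lemma anonymous: "anonymous f"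
  unfolding anonymous_def by (simp add: f_eq is_profile_rename_voters ballot_count_rename_voters)

lemma neutral: "neutral f"
  unfolding neutral_def
proof (intro allI impI)
  fix A :: "'c profile" and \<tau> :: "'c \<Rightarrow> 'c" assume A: "is_profile A" and \<tau>: "bij \<tau>"
  let ?v = "ballot_count (rename_cands \<tau> A)"
  have score: "weighted_score \<alpha> (ballot_count A) W = weighted_score \<alpha> ?v (\<tau> ` W)" for W
    using weighted_score_comp_bij[OF \<tau>, of \<alpha> ?v W] by (simp add: ballot_count_rename_cands[OF \<tau>])
  have surj: "\<exists>V. W = \<tau> ` V" for W using \<tau> by (metis bij_is_surj surj_image_vimage_eq)
  have comm: "\<tau> ` V \<in> committees k \<longleftrightarrow> V \<in> committees k" for V
    using \<tau> by (simp add: committees_def card_bij_image)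
  have ball: "(\<forall>W\<in>committees k. P W) \<longleftrightarrow> (\<forall>V\<in>committees k. P (\<tau> ` V))" for P
    using surj comm by metis
  have mem: "\<tau> ` V \<in> f (rename_cands \<tau> A) \<longleftrightarrow> V \<in> f A" for V
    unfolding f_eq[OF A] f_eq[OF is_profile_rename_cands[OF A]] score
    using comm ball[of "\<lambda>W. weighted_score \<alpha> ?v W \<le> weighted_score \<alpha> ?v (\<tau> ` V)"] by simp
  show "f (rename_cands \<tau> A) = image \<tau> ` f A"
  proof (intro set_eqI iffI)
    fix W assume W: "W \<in> f (rename_cands \<tau> A)"
    obtain V where "W = \<tau> ` V" using surj by blast
    then show "W \<in> image \<tau> ` f A" using W mem by blast
  qed (use mem in blast)
qed

lemma consistent: "consistent f"
  unfolding consistent_def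
proof (intro allI impI)
  fix A A' :: "'c profile"
  assume A: "is_profile A" and A': "is_profile A'" and disj: "disjoint_profiles A A'" and ne: "f A \<inter> f A' \<noteq> {}"
  let ?s = "weighted_score \<alpha> (ballot_count A)" and ?s' = "weighted_score \<alpha> (ballot_count A')"
  have score: "weighted_score \<alpha> (ballot_count (A ++ A')) W = ?s W + ?s' W" for W
    by (simp add: ballot_count_map_add[OF A A' disj] weighted_score_plus)
  \<comment> \<open>A common maximiser attains both maxima at once, so a maximiser of the summed
    score must attain each of them.\<close>
  obtain V where V: "V \<in> f A" "V \<in> f A'" using ne by blast
  show "f (A ++ A') = f A \<inter> f A'"
  proof (intro set_eqI iffI)
    fix W assume W: "W \<in> f (A ++ A')"
    have VW: "V \<in> committees k" "W \<in> committees k" "?s V + ?s' V \<le> ?s W + ?s' W"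
      using V W by (auto simp: f_eq A A' is_profile_map_add score)
    moreover have "?s W \<le> ?s V" "?s' W \<le> ?s' V" using V VW by (auto simp: f_eq A A')
    ultimately have "?s W = ?s V" "?s' W = ?s' V" by auto
    then show "W \<in> f A \<inter> f A'" using V VW by (simp add: f_eq A A')
  next
    fix W assume "W \<in> f A \<inter> f A'"
    then show "W \<in> f (A ++ A')" by (auto simp: f_eq A A' is_profile_map_add score intro: add_mono)
  qed
qed

lemma continuous: "continuous_rule f"
  unfolding continuous_rule_def
proof (intro allI impI)
  fix A A' :: "'c profile" assume A: "is_profile A" and A': "is_profile A'"
  let ?s = "weighted_score \<alpha> (ballot_count A)" and ?s' = "weighted_score \<alpha> (ballot_count A')"
  obtain V where V: "V \<in> f A" using abc A by (auto simp: abc_rule_def)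
  have gap: "?s W < ?s V" if "W \<in> committees k" "W \<notin> f A" for W
    using that V by (auto simp: f_eq A)
  \<comment> \<open>Enough copies of \<open>A\<close> let the deficit of a losing \<open>W\<close>
    outweigh its advantage in \<open>A'\<close>. There are finitely many committees, so the sum of
    these numbers yields one \<open>l\<close> for all.\<close>
  have "\<exists>n::nat. W \<in> committees k \<longrightarrow> W \<notin> f A \<longrightarrow> ?s' W - ?s' V < real n * (?s V - ?s W)" for W
    using gap[of W] reals_Archimedean3[of "?s V - ?s W"] by (metis diff_gt_0_iff_gt)
  then obtain n :: "'c set \<Rightarrow> nat"
    where n: "\<And>W. W \<in> committees k \<Longrightarrow> W \<notin> f A \<Longrightarrow> ?s' W - ?s' V < real (n W) * (?s V - ?s W)"
    by metis
  define l where "l = Suc (\<Sum>W\<in>UNIV. n W)"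
  have "f (B ++ A') \<subseteq> f A" if B: "copies l A B" and disj: "disjoint_profiles B A'" for B
  proof
    fix W assume W: "W \<in> f (B ++ A')"
    have profB: "is_profile B" by (rule copies_is_profile[OF A _ B]) (simp add: l_def)
    have "ballot_count (B ++ A') = of_nat l * ballot_count A + ballot_count A'"
      using ballot_count_map_add[OF profB A' disj] copies_ballot_count[OF A B] by simp
    then have score: "weighted_score \<alpha> (ballot_count (B ++ A')) U = real l * ?s U + ?s' U" for U
      by (simp only: weighted_score_plus weighted_score_of_nat_mult)
    have comm: "W \<in> committees k" "V \<in> committees k"
      using W V by (auto simp: f_eq A A' profB is_profile_map_add)
    have le: "real l * ?s V + ?s' V \<le> real l * ?s W + ?s' W"
      using W comm unfolding f_eq[OF is_profile_map_add[OF profB A']] score by blast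
    show "W \<in> f A"
    proof (rule ccontr)
      assume "W \<notin> f A"
      note gap[OF comm(1) this] n[OF comm(1) this]
      moreover have "n W \<le> l" unfolding l_def using member_le_sum[of W UNIV n] by simp
      then have "real (n W) \<le> real l" by simp
      ultimately have "?s' W - ?s' V < real l * (?s V - ?s W)"
        by (smt (verit) mult_right_mono)
      then show False using le by (simp add: algebra_simps)
    qed
  qed
  then show "\<exists>l\<ge>1. \<forall>B. copies l A B \<longrightarrow> disjoint_profiles B A' \<longrightarrow> f (B ++ A') \<subseteq> f A"
    by (intro exI[of _ l]) (simp add: l_def)
qed

lemma choice_set_convex: "choice_set_convex k f"
  unfolding choice_set_convex_def
proof (intro allI impI)
  fix A :: "'c profile" and W W' W'' :: "'c set"
  assume A: "is_profile A" and W: "W \<in> f A" and W': "W' \<in> f A" and W'': "W'' \<in> committees k"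
    and sub: "W \<inter> W' \<subseteq> W''" "W'' \<subseteq> W \<union> W'"
  let ?t = "candidate_score \<alpha> (ballot_count A)"
  have ex: "?t b \<le> ?t a" if "a \<in> W" "b \<notin> W" for a b using W that by (simp add: mem_iff_exchange[OF A])
  have ex': "?t b \<le> ?t a" if "a \<in> W'" "b \<notin> W'" for a b using W' that by (simp add: mem_iff_exchange[OF A])
  have "card W = card W'" using W W' by (simp add: mem_iff_exchange[OF A] committees_def)
  then have swap: "W - W' \<noteq> {} \<longleftrightarrow> W' - W \<noteq> {}"
    by (metis Diff_eq_empty_iff card_subset_eq finite)
  have "?t b \<le> ?t a" if ab: "a \<in> W''" "b \<notin> W''" for a b
  proof -
    \<comment> \<open>In the last two cases \<open>a\<close> and \<open>b\<close> lie on the same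
      side of the symmetric difference. A candidate \<open>c\<close> from the other side, present
      since the cardinalities agree, links them by
      \<open>?t b \<le> ?t c \<le> ?t a\<close>.\<close>
    consider "a \<in> W" "b \<notin> W" | "a \<in> W'" "b \<notin> W'" | "a \<in> W - W'" "b \<in> W - W'" | "a \<in> W' - W" "b \<in> W' - W"
      using ab sub by blast
    then show ?thesis
    proof cases
      case 3
      then obtain c where "c \<in> W' - W" using swap by blast
      then show ?thesis using 3 ex[of a c] ex'[of c b] by auto
    next
      case 4
      then obtain c where "c \<in> W - W'" using swap by blast
      then show ?thesis using 4 ex'[of a c] ex[of c b] by auto
    qed (auto intro: ex ex')
  qed
  then show "W'' \<in> f A" using W'' by (simp add: mem_iff_exchange[OF A])
qed

text \<open>An unapproved member scores 0, the least possible value as weights are non-negative.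
  Optimality then forces score 0 on all candidates outside \<open>W\<close>, so the exchange
  preserves the criterion \<open>mem_iff_exchange\<close>.\<close>

lemma weakly_efficient: "weakly_efficient f"
  unfolding weakly_efficient_def
proof (intro allI impI)
  fix A :: "'c profile" and W c c'
  assume A: "is_profile A" and W: "W \<in> f A" and c: "c \<in> W" "c \<notin> (\<Union>i\<in>dom A. the (A i))" and c': "c' \<notin> W"
  let ?t = "candidate_score \<alpha> (ballot_count A)"
  have "ballot_count A B = 0" if "c \<in> B" for B
  proof -
    have "{i. A i = Some B} = {}" using c(2) that by force
    then show ?thesis by (simp add: ballot_count_def)
  qed
  then have zero: "?t c = 0" by (simp add: candidate_score_def)
  have t_nonneg: "0 \<le> ?t x" for x
    unfolding candidate_score_def by (intro sum_nonneg) (simp add: nonneg ballot_count_def)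
  have comm: "W \<in> committees k" and ex: "\<And>a b. a \<in> W \<Longrightarrow> b \<notin> W \<Longrightarrow> ?t b \<le> ?t a"
    using W by (auto simp: mem_iff_exchange[OF A])
  have out: "?t b = 0" if "b \<notin> W" for b using ex[OF c(1) that] t_nonneg[of b] zero by simp
  have eq: "(W \<union> {c'}) - {c} = insert c' (W - {c})" using c c' by auto
  have "?t b \<le> ?t a" if "b \<notin> insert c' (W - {c})" for a b
    using that out[of b] zero t_nonneg[of a] by auto
  then show "(W \<union> {c'}) - {c} \<in> f A"
    unfolding eq mem_iff_exchange[OF A] using exchange_in_committees[OF comm c(1) c'] by blast
qed

end

theorem theorem2:
  fixes f :: "('c::finite) profile \<Rightarrow> 'c set set" and k :: nat
  assumes "card (UNIV :: 'c set) \<ge> 2" and "1 \<le> k" and "k < card (UNIV :: 'c set)"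
    and "abc_rule k f"
  shows "is_bswav k f \<longleftrightarrow>
    (anonymous f \<and> neutral f \<and> consistent f \<and> continuous_rule f \<and>
     choice_set_convex k f \<and> weakly_efficient f)"
proof
  assume "is_bswav k f"
  then obtain \<alpha> :: "nat \<Rightarrow> real" where \<alpha>: "\<forall>s. \<alpha> s \<ge> 0"
    and eq: "\<forall>A. is_profile A \<longrightarrow> f A = {W \<in> committees k.
      \<forall>W'\<in>committees k. bswav_score \<alpha> A W' \<le> bswav_score \<alpha> A W}"
    unfolding is_bswav_def by blast
  interpret bswav_rule f k \<alpha>
    using assms \<alpha> eq by unfold_locales (simp_all add: bswav_score_eq_weighted_score)
  show "anonymous f \<and> neutral f \<and> consistent f \<and> continuous_rule f \<and>
     choice_set_convex k f \<and> weakly_efficient f"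
    using anonymous neutral consistent continuous choice_set_convex weakly_efficient by simp
next
  assume "anonymous f \<and> neutral f \<and> consistent f \<and> continuous_rule f \<and>
     choice_set_convex k f \<and> weakly_efficient f"
  then interpret axiomatic_rule f k using assms by unfold_locales simp_all
  show "is_bswav k f" by (rule is_bswav)
qed

end
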